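(* Let $\alpha\in\Phi$ be a simple root, $\gamma\in\Phi^+\setminus\Phi_J^+$, and $w\in W^J$. Let $\theta$ be the highest root and define $z\in W_J$ by $r_\theta w=\lfloor r_\theta w\rfloor z$. Then we have the following cases, in each of which the bottom two edges (in $\mathrm{QB}(W^J)$) imply the top two edges, and vice versa. (1) In case (1a) we assume $\gamma\neq w^{-1}(\alpha)$. In both cases (1a) and (1b) we have $r_\alpha\lfloor wr_\gamma\rfloor=\lfloor r_\alpha wr_\gamma\rfloor$. (1a) Bottom edges: Bruhat edges $w\xrightarrow{w^{-1}(\alpha)}r_\alpha w$ and $w\xrightarrow{\gamma}\lfloor wr_\gamma\rfloor$. Top edges: Bruhat edges $r_\alpha w\xrightarrow{\gamma}r_\alpha\lfloor wr_\gamma\rfloor$ and $\lfloor wr_\gamma\rfloor\xrightarrow{\lfloor wr_\gamma\rfloor^{-1}(\alpha)}r_\alpha\lfloor wr_\gamma\rfloor$. (1b) Bottom edges: a Bruhat edge $w\xrightarrow{w^{-1}(\alpha)}r_\alpha w$ and a quantum edge $w\xrightarrow{\gamma}\lfloor wr_\gamma\rfloor$. Top edges: a quantum edge $r_\alpha w\xrightarrow{\gamma}r_\alpha\lfloor wr_\gamma\rfloor$ and a Bruhat edge $\lfloor wr_\gamma\rfloor\xrightarrow{\lfloor wr_\gamma\rfloor^{-1}(\alpha)}r_\alpha\lfloor wr_\gamma\rfloor$. (2) In cases (2a) and (2b) we assume $\gamma\neq-w^{-1}(\theta)$ whenever both of the hypothesized edges are quantum ones. (2a) Bottom edges: a quantum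 edge $w\xrightarrow{-w^{-1}(\theta)}\lfloor r_\theta w\rfloor$ and a Bruhat edge $w\xrightarrow{\gamma}\lfloor wr_\gamma\rfloor$. Top edges: an edge $\lfloor r_\theta w\rfloor\xrightarrow{z(\gamma)}\lfloor r_\theta wr_\gamma\rfloor$, which is a quantum (resp. a Bruhat) edge depending on $\langle w^{-1}(\theta),\gamma^\vee\rangle$ being nonzero (resp. zero), and a quantum edge $\lfloor wr_\gamma\rfloor\xrightarrow{-\lfloor wr_\gamma\rfloor^{-1}(\theta)}\lfloor r_\theta wr_\gamma\rfloor$. (2b) Bottom edges: quantum edges $w\xrightarrow{-w^{-1}(\theta)}\lfloor r_\theta w\rfloor$ and $w\xrightarrow{\gamma}\lfloor wr_\gamma\rfloor$. Top edges: an edge $\lfloor r_\theta w\rfloor\xrightarrow{z(\gamma)}\lfloor r_\theta wr_\gamma\rfloor$, which is a Bruhat (resp. a quantum) edge depending on $\langle w^{-1}(\theta),\gamma^\vee\rangle$ being nonzero (resp. zero), and a quantum edge $\lfloor wr_\gamma\rfloor\xrightarrow{-\lfloor wr_\gamma\rfloor^{-1}(\theta)}\lfloor r_\theta wr_\gamma\rfloor$.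
   Context: Let $\mathfrak g$ be a finite-dimensional simple Lie algebra with roots $\Phi\supset\Phi^+$, weight lattice $X$, Weyl group $W$ (reflections $r_\alpha$, length $\ell$), and $\rho$ half the sum of the positive roots; $\langle\cdot,\cdot\rangle$ is the pairing between weights and coroots, written in either order. Fix a dominant $\lambda\in X$; $J=\{i:\langle\alpha_i^\vee,\lambda\rangle=0\}$, $W_J$ is the stabilizer of $\lambda$ (generated by the simple reflections $r_i$, $i\in J$), $\Phi_J^+$ its positive roots, $\rho_J$ half their sum, $W^J$ the set of minimal-length representatives of $W/W_J$, and $\lfloor v\rfloor$ the minimal-length element of $vW_J$. Parabolic quantum Bruhat graph $\mathrm{QB}(W^J)$: the directed graph with vertex set $W^J$ and edges $w\xrightarrow{\gamma}\lfloor wr_\gamma\rfloor$ for $w\in W^J$, $\gamma\in\Phi^+\setminus\Phi_J^+$ such that either (Bruhat edge) $wr_\gamma$ covers $w$ in Bruhat order (then $wr_\gamma\in W^J$), or (quantum edge) $\ell(\lfloor wr_\gamma\rfloor)=\ell(w)+1-\langle\gamma^\vee,2\rho-2\rho_J\rangle$. Each case is a diamond-shaped diagram: the two bottom edges start at $w$, and the two top edges end at the common top vertex. The "hypothesized edges" are the two edges (bottom or top) from which the other two are deduced.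
   Formalization: For top ⇒ bottom, the condition γ≠w^{-1}(α) in (1a) is replaced by γ≠−w^{-1}(α), and in (2a) γ≠−w^{-1}(θ) is replaced by γ≠w^{-1}(θ) when ⟨w^{-1}(θ),γ^∨⟩≠0; as printed these directions fail in type A_1 (w=r_α, γ=α, resp. w=1, γ=θ). *)

theory Defs
  imports "HOL-Analysis.Analysis"
begin

text \<open>
  The simple Lie algebra enters only through its root system, which is taken to be an arbitrary
  irreducible reduced crystallographic root system \<open>\<Phi>\<close> spanning a Euclidean space \<open>'a\<close>, with base
  \<open>\<Delta>\<close>. The space \<open>'a\<close> plays the role of the real span of the weight lattice; it is identified with its
  dual by the inner product, so the coroot of \<open>\<alpha>\<close> is \<open>2 \<alpha> / (\<alpha> \<bullet> \<alpha>)\<close>. Weyl group elements are the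
  actual linear maps \<open>'a \<Rightarrow> 'a\<close>, multiplied by composition.
\<close>

subsection \<open>Root systems\<close>

definition coroot :: "'a::euclidean_space \<Rightarrow> 'a" where
  "coroot \<alpha> = (2 / (\<alpha> \<bullet> \<alpha>)) *\<^sub>R \<alpha>"

definition reflection :: "'a::euclidean_space \<Rightarrow> 'a \<Rightarrow> 'a" where
  "reflection \<alpha> v = v - (coroot \<alpha> \<bullet> v) *\<^sub>R \<alpha>"

definition root_system :: "'a::euclidean_space set \<Rightarrow> bool" where
  "root_system \<Phi> \<longleftrightarrow>
     finite \<Phi> \<and> 0 \<notin> \<Phi> \<and> span \<Phi> = UNIV \<and>
     (\<forall>\<alpha>\<in>\<Phi>. reflection \<alpha> ` \<Phi> \<subseteq> \<Phi>) \<and>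
     (\<forall>\<alpha>\<in>\<Phi>. \<forall>\<beta>\<in>\<Phi>. coroot \<alpha> \<bullet> \<beta> \<in> \<int>) \<and>
     (\<forall>\<alpha>\<in>\<Phi>. \<forall>c. c *\<^sub>R \<alpha> \<in> \<Phi> \<longrightarrow> c = 1 \<or> c = -1)"

definition irreducible_root_system :: "'a::euclidean_space set \<Rightarrow> bool" where
  "irreducible_root_system \<Phi> \<longleftrightarrow>
     root_system \<Phi> \<and> \<Phi> \<noteq> {} \<and>
     \<not> (\<exists>A B. A \<noteq> {} \<and> B \<noteq> {} \<and> A \<union> B = \<Phi> \<and> (\<forall>a\<in>A. \<forall>b\<in>B. a \<bullet> b = 0))"

definition nonneg_cone :: "'a::euclidean_space set \<Rightarrow> 'a set" where
  "nonneg_cone \<Delta> = {(\<Sum>\<delta>\<in>\<Delta>. real (c \<delta>) *\<^sub>R \<delta>) | c :: 'a \<Rightarrow> nat. True}"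

definition is_base :: "'a::euclidean_space set \<Rightarrow> 'a set \<Rightarrow> bool" where
  "is_base \<Phi> \<Delta> \<longleftrightarrow>
     \<Delta> \<subseteq> \<Phi> \<and> independent \<Delta> \<and> (\<forall>\<beta>\<in>\<Phi>. \<beta> \<in> nonneg_cone \<Delta> \<or> - \<beta> \<in> nonneg_cone \<Delta>)"

definition pos_roots :: "'a::euclidean_space set \<Rightarrow> 'a set \<Rightarrow> 'a set" where
  "pos_roots \<Phi> \<Delta> = \<Phi> \<inter> nonneg_cone \<Delta>"

definition highest_root :: "'a::euclidean_space set \<Rightarrow> 'a set \<Rightarrow> 'a \<Rightarrow> bool" where
  "highest_root \<Phi> \<Delta> \<theta> \<longleftrightarrow> \<theta> \<in> \<Phi> \<and> (\<forall>\<beta>\<in>\<Phi>. \<theta> - \<beta> \<in> nonneg_cone \<Delta>)"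

definition weight_lattice :: "'a::euclidean_space set \<Rightarrow> 'a set" where
  "weight_lattice \<Phi> = {\<mu>. \<forall>\<alpha>\<in>\<Phi>. coroot \<alpha> \<bullet> \<mu> \<in> \<int>}"

definition dominant :: "'a::euclidean_space set \<Rightarrow> 'a \<Rightarrow> bool" where
  "dominant \<Delta> \<mu> \<longleftrightarrow> (\<forall>\<alpha>\<in>\<Delta>. coroot \<alpha> \<bullet> \<mu> \<ge> 0)"

subsection \<open>The Weyl group\<close>

definition refl_word :: "'a::euclidean_space list \<Rightarrow> 'a \<Rightarrow> 'a" where
  "refl_word \<alpha>s = foldr (\<circ>) (map reflection \<alpha>s) id"

definition weyl_group :: "'a::euclidean_space set \<Rightarrow> ('a \<Rightarrow> 'a) set" where
  "weyl_group \<Phi> = {refl_word \<alpha>s | \<alpha>s. set \<alpha>s \<subseteq> \<Phi>}"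

definition len :: "'a::euclidean_space set \<Rightarrow> ('a \<Rightarrow> 'a) \<Rightarrow> nat" where
  "len \<Delta> w = (LEAST n. \<exists>\<alpha>s. set \<alpha>s \<subseteq> \<Delta> \<and> length \<alpha>s = n \<and> refl_word \<alpha>s = w)"

definition bruhat_less ::
  "'a::euclidean_space set \<Rightarrow> 'a set \<Rightarrow> ('a \<Rightarrow> 'a) \<Rightarrow> ('a \<Rightarrow> 'a) \<Rightarrow> bool" where
  "bruhat_less \<Phi> \<Delta> =
     (\<lambda>u v. u \<in> weyl_group \<Phi> \<and> (\<exists>\<beta>\<in>\<Phi>. v = u \<circ> reflection \<beta>) \<and> len \<Delta> u < len \<Delta> v)\<^sup>+\<^sup>+"

definition bruhat_covers ::
  "'a::euclidean_space set \<Rightarrow> 'a set \<Rightarrow> ('a \<Rightarrow> 'a) \<Rightarrow> ('a \<Rightarrow> 'a) \<Rightarrow> bool" where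
  \<comment> \<open>\<open>v\<close> covers \<open>u\<close>\<close>
  "bruhat_covers \<Phi> \<Delta> v u \<longleftrightarrow>
     bruhat_less \<Phi> \<Delta> u v \<and> \<not> (\<exists>x. bruhat_less \<Phi> \<Delta> u x \<and> bruhat_less \<Phi> \<Delta> x v)"

subsection \<open>The parabolic data attached to a dominant weight\<close>

text \<open>
  The index set \<open>J\<close> (simple roots orthogonal to \<open>\<mu>\<close>) enters only through \<open>W\<^sub>J\<close>, the stabilizer of \<open>\<mu>\<close>;
  so the notions below take \<open>\<mu>\<close> itself as parameter. The roots of \<open>W\<^sub>J\<close> are those whose reflection
  lies in \<open>W\<^sub>J\<close>.
\<close>

definition W_stab :: "'a::euclidean_space set \<Rightarrow> 'a \<Rightarrow> ('a \<Rightarrow> 'a) set" where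
  "W_stab \<Phi> \<mu> = {u \<in> weyl_group \<Phi>. u \<mu> = \<mu>}"

definition pos_roots_stab ::
  "'a::euclidean_space set \<Rightarrow> 'a set \<Rightarrow> 'a \<Rightarrow> 'a set" where
  "pos_roots_stab \<Phi> \<Delta> \<mu> = {\<beta> \<in> pos_roots \<Phi> \<Delta>. reflection \<beta> \<in> W_stab \<Phi> \<mu>}"

definition rho :: "'a::euclidean_space set \<Rightarrow> 'a set \<Rightarrow> 'a" where
  "rho \<Phi> \<Delta> = (1/2) *\<^sub>R (\<Sum>\<beta>\<in>pos_roots \<Phi> \<Delta>. \<beta>)"

definition rho_stab :: "'a::euclidean_space set \<Rightarrow> 'a set \<Rightarrow> 'a \<Rightarrow> 'a" where
  "rho_stab \<Phi> \<Delta> \<mu> = (1/2) *\<^sub>R (\<Sum>\<beta>\<in>pos_roots_stab \<Phi> \<Delta> \<mu>. \<beta>)"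

definition is_min_rep ::
  "'a::euclidean_space set \<Rightarrow> 'a set \<Rightarrow> 'a \<Rightarrow> ('a \<Rightarrow> 'a) \<Rightarrow> ('a \<Rightarrow> 'a) \<Rightarrow> bool" where
  \<comment> \<open>\<open>u\<close> has minimal length in the coset \<open>v W\<^sub>J\<close>\<close>
  "is_min_rep \<Phi> \<Delta> \<mu> v u \<longleftrightarrow>
     u \<in> (\<circ>) v ` W_stab \<Phi> \<mu> \<and> (\<forall>u'\<in>(\<circ>) v ` W_stab \<Phi> \<mu>. len \<Delta> u \<le> len \<Delta> u')"

definition min_reps ::
  "'a::euclidean_space set \<Rightarrow> 'a set \<Rightarrow> 'a \<Rightarrow> ('a \<Rightarrow> 'a) set" where
  "min_reps \<Phi> \<Delta> \<mu> = {u. \<exists>v\<in>weyl_group \<Phi>. is_min_rep \<Phi> \<Delta> \<mu> v u}"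

definition min_rep ::
  "'a::euclidean_space set \<Rightarrow> 'a set \<Rightarrow> 'a \<Rightarrow> ('a \<Rightarrow> 'a) \<Rightarrow> ('a \<Rightarrow> 'a)" where
  "min_rep \<Phi> \<Delta> \<mu> v = (THE u. is_min_rep \<Phi> \<Delta> \<mu> v u)"

subsection \<open>The parabolic quantum Bruhat graph\<close>

text \<open>
  \<open>bruhat_edge \<Phi> \<Delta> \<mu> w \<gamma> v\<close> and \<open>quantum_edge \<Phi> \<Delta> \<mu> w \<gamma> v\<close> say that the graph has an edge of the
  given kind from \<open>w\<close> to \<open>v\<close> labelled \<open>\<gamma>\<close>. In particular they assert that the source is a vertex,
  that the label is an admissible positive root, and that the target is the minimal
  representative \<open>\<lfloor>w r\<^sub>\<gamma>\<rfloor>\<close>.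
\<close>

definition bruhat_edge ::
  "'a::euclidean_space set \<Rightarrow> 'a set \<Rightarrow> 'a \<Rightarrow> ('a \<Rightarrow> 'a) \<Rightarrow> 'a \<Rightarrow> ('a \<Rightarrow> 'a) \<Rightarrow> bool" where
  "bruhat_edge \<Phi> \<Delta> \<mu> w \<gamma> v \<longleftrightarrow>
     w \<in> min_reps \<Phi> \<Delta> \<mu> \<and>
     \<gamma> \<in> pos_roots \<Phi> \<Delta> - pos_roots_stab \<Phi> \<Delta> \<mu> \<and>
     v = min_rep \<Phi> \<Delta> \<mu> (w \<circ> reflection \<gamma>) \<and>
     bruhat_covers \<Phi> \<Delta> (w \<circ> reflection \<gamma>) w"

definition quantum_edge ::
  "'a::euclidean_space set \<Rightarrow> 'a set \<Rightarrow> 'a \<Rightarrow> ('a \<Rightarrow> 'a) \<Rightarrow> 'a \<Rightarrow> ('a \<Rightarrow> 'a) \<Rightarrow> bool" where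
  "quantum_edge \<Phi> \<Delta> \<mu> w \<gamma> v \<longleftrightarrow>
     w \<in> min_reps \<Phi> \<Delta> \<mu> \<and>
     \<gamma> \<in> pos_roots \<Phi> \<Delta> - pos_roots_stab \<Phi> \<Delta> \<mu> \<and>
     v = min_rep \<Phi> \<Delta> \<mu> (w \<circ> reflection \<gamma>) \<and>
     real (len \<Delta> v) =
       real (len \<Delta> w) + 1 - coroot \<gamma> \<bullet> (2 *\<^sub>R rho \<Phi> \<Delta> - 2 *\<^sub>R rho_stab \<Phi> \<Delta> \<mu>)"

end

theory Submission
  imports Defs
begin

text \<open>
  Let \<open>P\<close> be the set of roots pairing positively with \<open>\<mu>\<close>, which is \<open>\<Phi>\<^sup>+ - \<Phi>\<^sub>J\<^sup>+\<close>. The length of the minimal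
  representative of \<open>w W\<^sub>J\<close> is the number of \<open>\<beta> \<in> P\<close> with \<open>w \<beta> < 0\<close>. Comparing these numbers for \<open>w\<close>
  and \<open>w r\<^sub>\<gamma>\<close> shows that a quantum edge is the case of equality in a general lower bound, and equality
  means: every \<open>\<beta> \<in> P\<close> with \<open>r\<^sub>\<gamma> \<beta> \<notin> P\<close> satisfies \<open>w \<beta> < 0 < w r\<^sub>\<gamma> \<beta>\<close>, and \<open>\<langle>\<gamma>\<^sup>\<or>, \<beta>\<rangle> = 1\<close> unless \<open>\<beta> = \<gamma>\<close>.
  Since \<open>\<theta>\<close> pairs with positive roots other than itself to 0 or 1, left multiplication by \<open>r\<^sub>\<theta>\<close> gives a
  quantum edge exactly when \<open>- w\<^sup>-\<^sup>1 \<theta> \<in> P\<close>, and the change of length is then explicit. The diamonds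
  follow by adding lengths; the remaining sign conditions come from applying the equality criterion to
  \<open>- r\<^sub>\<gamma> \<beta>\<close> for suitable \<open>\<beta>\<close>.
\<close>

text \<open>The type of the opposite edge in the diamonds with \<theta> is decided by one integer k,
  the pairing of the coroot of \<theta> with w \<gamma>. Comparing the length formula for r_\<theta>
  at w and at w r_\<gamma> leaves a single extra term: k times the pairing of the coroot of \<gamma>
  with 2\<rho> - 2\<rho>_J. Hence k = 0 keeps the type of the edge, k = 1 turns a Bruhat edge into a
  quantum one, and k = -1 turns a quantum edge into a Bruhat one. The remaining values k = 2 and k =
  -2 occur only for w \<gamma> = \<theta> and w \<gamma> = - \<theta>; these are ruled out by the
  excluded labels, or by signs of pairings with \<mu>.

  The obstacle is that a Bruhat edge is more than a length condition: its target w r_\<gamma> has to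
  be minimal in its coset, which constrains the signs of the images of all roots orthogonal to
  \<mu>, and lengths do not control these. In addition r_\<theta> w is in general not minimal.
  Lengths and sign conditions are therefore put in a form invariant under right multiplication by
  W_J, after which z and the floors drop out.\<close>

lemma coroot_inner_self: "\<alpha> \<noteq> 0 \<Longrightarrow> coroot \<alpha> \<bullet> \<alpha> = 2"
  by (simp add: coroot_def)

lemma coroot_uminus: "coroot (- \<alpha>) = - coroot \<alpha>"
  by (simp add: coroot_def)

lemma coroot_inner_pos_iff: "\<alpha> \<noteq> 0 \<Longrightarrow> 0 < coroot \<alpha> \<bullet> x \<longleftrightarrow> 0 < \<alpha> \<bullet> x"
  by (simp add: coroot_def zero_less_mult_iff zero_less_divide_iff
      not_less[THEN iffD2, OF inner_ge_zero])

lemma coroot_inner_eq_0_iff: "\<alpha> \<noteq> 0 \<Longrightarrow> coroot \<alpha> \<bullet> x = 0 \<longleftrightarrow> \<alpha> \<bullet> x = 0"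
  by (simp add: coroot_def)

lemma coroot_inner_neg_iff: "\<alpha> \<noteq> 0 \<Longrightarrow> coroot \<alpha> \<bullet> x < 0 \<longleftrightarrow> \<alpha> \<bullet> x < 0"
  using coroot_inner_pos_iff[of \<alpha> "- x"] by simp

lemma reflection_self: "\<alpha> \<noteq> 0 \<Longrightarrow> reflection \<alpha> \<alpha> = - \<alpha>"
  by (simp add: reflection_def coroot_inner_self scaleR_2)

lemma reflection_uminus: "reflection (- \<alpha>) = reflection \<alpha>"
  by (rule ext) (simp add: reflection_def coroot_uminus)

lemma linear_reflection: "linear (reflection \<alpha>)"
  by (rule linearI) (simp_all add: reflection_def inner_add_right algebra_simps)

lemma inner_reflection: "reflection \<alpha> x \<bullet> reflection \<alpha> y = x \<bullet> y"
  by (cases "\<alpha> = 0")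
     (simp_all add: reflection_def coroot_def inner_diff_left inner_diff_right inner_commute
        algebra_simps)

lemma orthogonal_reflection: "orthogonal_transformation (reflection \<alpha>)"
  by (simp add: orthogonal_transformation_def linear_reflection inner_reflection)

lemma reflection_reflection [simp]: "reflection \<alpha> (reflection \<alpha> x) = x"
  by (cases "\<alpha> = 0") (simp_all add: reflection_def coroot_def inner_diff_right algebra_simps)

lemma reflection_comp_self [simp]: "reflection \<alpha> \<circ> reflection \<alpha> = id"
  by (rule ext) simp

lemma comp_reflection_cancel [simp]:
  "f \<circ> reflection \<alpha> \<circ> reflection \<alpha> = f" "reflection \<alpha> \<circ> (reflection \<alpha> \<circ> f) = f"
  by (rule ext, simp)+

lemma coroot_inner_reflection: "\<alpha> \<noteq> 0 \<Longrightarrow> coroot \<alpha> \<bullet> reflection \<alpha> x = - (coroot \<alpha> \<bullet> x)"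
  by (simp add: reflection_def inner_diff_right coroot_inner_self)

lemma coroot_orthogonal:
  "orthogonal_transformation f \<Longrightarrow> coroot (f \<alpha>) = f (coroot \<alpha>)"
  by (simp add: coroot_def orthogonal_transformation_def linear_cmul)

lemma reflection_orthogonal:
  assumes "orthogonal_transformation f"
  shows "reflection (f \<alpha>) (f x) = f (reflection \<alpha> x)"
proof -
  have "f (coroot \<alpha>) \<bullet> f x = coroot \<alpha> \<bullet> x"
    using assms by (simp add: orthogonal_transformation_def)
  then show ?thesis
    using assms
    by (simp add: reflection_def coroot_orthogonal linear_diff linear_cmul
        orthogonal_transformation_linear)
qed

lemma refl_word_simps [simp]:
  "refl_word [] = id"
  "refl_word (a # as) = reflection a \<circ> refl_word as"
  by (simp_all add: refl_word_def)

lemma refl_word_append: "refl_word (as @ bs) = refl_word as \<circ> refl_word bs"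
  by (induction as) (simp_all add: comp_assoc)

lemma refl_word_snoc: "refl_word (as @ [a]) = refl_word as \<circ> reflection a"
  by (simp only: refl_word_append refl_word_simps comp_id)

lemma orthogonal_refl_word: "orthogonal_transformation (refl_word as)"
proof (induction as)
  case (Cons a as)
  then show ?case
    by (simp only: refl_word_simps orthogonal_transformation_compose orthogonal_reflection)
qed (simp add: orthogonal_transformation_def linear_id)

lemma refl_word_rev: "refl_word (rev as) (refl_word as x) = x"
  by (induction as arbitrary: x) (simp_all add: refl_word_append)

subsection \<open>Roots, heights and the Weyl group\<close>

locale based_root_system =
  fixes \<Phi> \<Delta> :: "'a::euclidean_space set"
  assumes root_system: "root_system \<Phi>" and is_base: "is_base \<Phi> \<Delta>"
begin

abbreviation "W \<equiv> weyl_group \<Phi>"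

lemma finite_roots: "finite \<Phi>" and zero_not_root: "0 \<notin> \<Phi>" and span_roots: "span \<Phi> = UNIV"
  and reflection_root: "\<alpha> \<in> \<Phi> \<Longrightarrow> \<beta> \<in> \<Phi> \<Longrightarrow> reflection \<alpha> \<beta> \<in> \<Phi>"
  and coroot_Ints: "\<alpha> \<in> \<Phi> \<Longrightarrow> \<beta> \<in> \<Phi> \<Longrightarrow> coroot \<alpha> \<bullet> \<beta> \<in> \<int>"
  and reduced: "\<alpha> \<in> \<Phi> \<Longrightarrow> c *\<^sub>R \<alpha> \<in> \<Phi> \<Longrightarrow> c = 1 \<or> c = -1"
  using root_system unfolding root_system_def by blast+

lemma base_subset: "\<Delta> \<subseteq> \<Phi>" and base_independent: "independent \<Delta>"
  and root_cone: "\<beta> \<in> \<Phi> \<Longrightarrow> \<beta> \<in> nonneg_cone \<Delta> \<or> - \<beta> \<in> nonneg_cone \<Delta>"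
  using is_base unfolding is_base_def by blast+

lemma root_nonzero: "\<alpha> \<in> \<Phi> \<Longrightarrow> \<alpha> \<noteq> 0"
  using zero_not_root by blast

lemma uminus_root: "\<alpha> \<in> \<Phi> \<Longrightarrow> - \<alpha> \<in> \<Phi>"
  using reflection_root[of \<alpha> \<alpha>] by (simp add: reflection_self root_nonzero)

lemma finite_base: "finite \<Delta>"
  using base_subset finite_roots finite_subset by blast

lemma nonneg_cone_span: "x \<in> nonneg_cone \<Delta> \<Longrightarrow> x \<in> span \<Delta>"
  unfolding nonneg_cone_def by clarify (intro span_sum span_scale span_base)

lemma span_base_UNIV: "span \<Delta> = UNIV"
proof -
  have "\<Phi> \<subseteq> span \<Delta>"
    using root_cone nonneg_cone_span span_neg by fastforce
  then have "span \<Phi> \<subseteq> span \<Delta>"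
    by (simp add: span_minimal)
  then show ?thesis using span_roots by auto
qed

definition coord :: "'a \<Rightarrow> 'a \<Rightarrow> real" where
  "coord \<delta> x = representation \<Delta> x \<delta>"

text \<open>A linear functional that is positive exactly on the positive roots, so that positivity
  of a root becomes the sign of a real number and can be handled by linear arithmetic.\<close>

definition ht :: "'a \<Rightarrow> real" where
  "ht x = (\<Sum>\<delta>\<in>\<Delta>. coord \<delta> x)"

lemma linear_coord: "linear (coord \<delta>)"
  by (rule linearI)
    (simp_all add: coord_def real_vector.representation_add real_vector.representation_scale base_independent span_base_UNIV)

lemma linear_ht: "linear ht"
  unfolding ht_def using linear_coord by (intro linear_compose_sum) blast

lemmas ht_simps [simp] = linear_add[OF linear_ht] linear_diff[OF linear_ht]
  linear_neg[OF linear_ht] linear_cmul[OF linear_ht] linear_0[OF linear_ht]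

lemma coord_base: "\<delta> \<in> \<Delta> \<Longrightarrow> \<epsilon> \<in> \<Delta> \<Longrightarrow> coord \<epsilon> \<delta> = (if \<epsilon> = \<delta> then 1 else 0)"
  by (simp add: coord_def real_vector.representation_basis base_independent)

lemma coord_sum: "\<epsilon> \<in> \<Delta> \<Longrightarrow> coord \<epsilon> (\<Sum>\<delta>\<in>\<Delta>. c \<delta> *\<^sub>R \<delta>) = c \<epsilon>"
  by (simp add: linear_sum[OF linear_coord] linear_cmul[OF linear_coord] coord_base finite_base
      if_distrib cong: if_cong)

lemma coord_expand: "x = (\<Sum>\<delta>\<in>\<Delta>. coord \<delta> x *\<^sub>R \<delta>)"
  unfolding coord_def
  by (simp add: real_vector.sum_representation_eq base_independent span_base_UNIV finite_base)

lemma ht_base: "\<delta> \<in> \<Delta> \<Longrightarrow> ht \<delta> = 1"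
  by (simp add: ht_def coord_base finite_base)

lemma nonneg_cone_coord: "x \<in> nonneg_cone \<Delta> \<Longrightarrow> \<delta> \<in> \<Delta> \<Longrightarrow> 0 \<le> coord \<delta> x"
  unfolding nonneg_cone_def by (auto simp: coord_sum)

lemma nonneg_cone_ht: "x \<in> nonneg_cone \<Delta> \<Longrightarrow> 0 \<le> ht x"
  unfolding ht_def by (simp add: sum_nonneg nonneg_cone_coord)

lemma nonneg_cone_ht_0:
  assumes "x \<in> nonneg_cone \<Delta>" "ht x = 0" shows "x = 0"
proof -
  have "\<forall>\<delta>\<in>\<Delta>. coord \<delta> x = 0"
    using assms by (simp add: ht_def sum_nonneg_eq_0_iff nonneg_cone_coord finite_base)
  then show ?thesis using coord_expand[of x] by simp
qed

lemma root_ht_nonzero: "\<beta> \<in> \<Phi> \<Longrightarrow> ht \<beta> \<noteq> 0"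
  using root_cone nonneg_cone_ht_0 root_nonzero by fastforce

lemma root_ht_cases: "\<beta> \<in> \<Phi> \<Longrightarrow> 0 < ht \<beta> \<or> ht \<beta> < 0"
  using root_ht_nonzero by fastforce

lemma pos_root_cone: "\<beta> \<in> \<Phi> \<Longrightarrow> 0 < ht \<beta> \<Longrightarrow> \<beta> \<in> nonneg_cone \<Delta>"
  using root_cone nonneg_cone_ht by fastforce

lemma pos_roots_eq: "pos_roots \<Phi> \<Delta> = {\<beta> \<in> \<Phi>. 0 < ht \<beta>}"
  unfolding pos_roots_def using pos_root_cone nonneg_cone_ht root_ht_nonzero
  by (fastforce simp: less_le)

text \<open>Positive roots have nonnegative coordinates in the base. Used below for pairings with
  fixed vectors and for heights of Weyl group images.\<close>

lemma pos_root_nonneg: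
  assumes "\<beta> \<in> \<Phi>" "0 < ht \<beta>" "linear f" "\<And>\<delta>. \<delta> \<in> \<Delta> \<Longrightarrow> 0 \<le> (f \<delta> :: real)"
  shows "0 \<le> f \<beta>"
proof -
  have "f \<beta> = (\<Sum>\<delta>\<in>\<Delta>. coord \<delta> \<beta> *\<^sub>R f \<delta>)"
    using arg_cong[OF coord_expand[of \<beta>], of f]
    by (simp add: linear_sum[OF assms(3)] linear_cmul[OF assms(3)])
  also have "\<dots> \<ge> 0"
    using assms pos_root_cone nonneg_cone_coord by (intro sum_nonneg) (simp add: assms)
  finally show ?thesis .
qed

text \<open>The reflection changes only the \<alpha>-coordinate. If the image of \<beta> were
  negative, every other coordinate of \<beta> would be both nonnegative and nonpositive, so \<beta>
  would be a multiple of \<alpha>, hence \<alpha> itself because the root system is reduced.\<close>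

lemma simple_reflection_pos:
  assumes "\<alpha> \<in> \<Delta>" "\<beta> \<in> \<Phi>" "0 < ht \<beta>" "\<beta> \<noteq> \<alpha>"
  shows "0 < ht (reflection \<alpha> \<beta>)"
proof (rule ccontr)
  assume neg: "\<not> ?thesis"
  have "\<alpha> \<in> \<Phi>" using assms base_subset by blast
  then have r: "reflection \<alpha> \<beta> \<in> \<Phi>" using assms reflection_root by blast
  have n: "- reflection \<alpha> \<beta> \<in> nonneg_cone \<Delta>"
    using neg root_cone[OF r] nonneg_cone_ht root_ht_nonzero[OF r] by fastforce
  have "coord \<delta> \<beta> = 0" if "\<delta> \<in> \<Delta>" "\<delta> \<noteq> \<alpha>" for \<delta>
  proof -
    have "coord \<delta> (- reflection \<alpha> \<beta>) = - coord \<delta> \<beta>"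
      using that assms
      by (simp add: reflection_def linear_diff[OF linear_coord] linear_cmul[OF linear_coord]
          linear_neg[OF linear_coord] coord_base)
    then show ?thesis
      using nonneg_cone_coord[OF n that(1)]
        nonneg_cone_coord[OF pos_root_cone[OF assms(2,3)] that(1)] by linarith
  qed
  then have "(\<Sum>\<delta>\<in>\<Delta>. coord \<delta> \<beta> *\<^sub>R \<delta>) = (\<Sum>\<delta>\<in>{\<alpha>}. coord \<delta> \<beta> *\<^sub>R \<delta>)"
    using finite_base assms by (intro sum.mono_neutral_right) auto
  then have b: "\<beta> = coord \<alpha> \<beta> *\<^sub>R \<alpha>"
    using coord_expand[of \<beta>] by simp
  then have "coord \<alpha> \<beta> = 1 \<or> coord \<alpha> \<beta> = -1"
    using reduced[OF \<open>\<alpha> \<in> \<Phi>\<close>, of "coord \<alpha> \<beta>"] assms by simp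
  moreover have "0 < coord \<alpha> \<beta>"
    using arg_cong[OF b, of ht] ht_base[OF assms(1)] assms(3) by simp
  ultimately show False using b assms(4) by simp
qed

lemma weyl_orthogonal: "w \<in> W \<Longrightarrow> orthogonal_transformation w"
  unfolding weyl_group_def using orthogonal_refl_word by blast

lemma weyl_linear: "w \<in> W \<Longrightarrow> linear w"
  using weyl_orthogonal orthogonal_transformation_linear by blast

lemma weyl_inner [simp]: "w \<in> W \<Longrightarrow> w x \<bullet> w y = x \<bullet> y"
  using weyl_orthogonal unfolding orthogonal_transformation_def by blast

lemma weyl_bij: "w \<in> W \<Longrightarrow> bij w"
  using weyl_orthogonal orthogonal_transformation_bij by blast

lemma weyl_root: "w \<in> W \<Longrightarrow> \<beta> \<in> \<Phi> \<Longrightarrow> w \<beta> \<in> \<Phi>"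
proof -
  have "set as \<subseteq> \<Phi> \<Longrightarrow> \<beta> \<in> \<Phi> \<Longrightarrow> refl_word as \<beta> \<in> \<Phi>" for as
    by (induction as) (auto simp: reflection_root)
  then show "w \<in> W \<Longrightarrow> \<beta> \<in> \<Phi> \<Longrightarrow> w \<beta> \<in> \<Phi>"
    unfolding weyl_group_def by blast
qed

lemma weyl_comp: "u \<in> W \<Longrightarrow> v \<in> W \<Longrightarrow> u \<circ> v \<in> W"
  unfolding weyl_group_def by clarify (metis le_sup_iff refl_word_append set_append)

lemma weyl_reflection: "\<beta> \<in> \<Phi> \<Longrightarrow> reflection \<beta> \<in> W"
  unfolding weyl_group_def by (auto intro!: exI[of _ "[\<beta>]"])

lemma weyl_id: "id \<in> W"
  unfolding weyl_group_def by (auto intro!: exI[of _ "[]"])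

lemma weyl_inv: "w \<in> W \<Longrightarrow> inv w \<in> W"
proof -
  assume "w \<in> W"
  then obtain as where as: "set as \<subseteq> \<Phi>" "w = refl_word as"
    unfolding weyl_group_def by blast
  have "refl_word (rev as) x = inv w x" for x
    using refl_word_rev[of as "inv w x"] weyl_bij[OF \<open>w \<in> W\<close>] as
    by (simp add: bij_is_surj surj_f_inv_f)
  then have "refl_word (rev as) = inv w" by blast
  then show "inv w \<in> W" using as unfolding weyl_group_def by (metis (mono_tags) mem_Collect_eq set_rev)
qed

lemma weyl_inv_apply [simp]: "w \<in> W \<Longrightarrow> inv w (w x) = x" "w \<in> W \<Longrightarrow> w (inv w x) = x"
  using weyl_bij by (auto simp: bij_def surj_f_inv_f)

lemma weyl_uminus: "w \<in> W \<Longrightarrow> w (- x) = - w x"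
  and weyl_diff: "w \<in> W \<Longrightarrow> w (x - y) = w x - w y"
  and weyl_scale: "w \<in> W \<Longrightarrow> w (c *\<^sub>R x) = c *\<^sub>R w x"
  by (simp_all add: linear_neg linear_diff linear_cmul weyl_linear)

lemma weyl_eq_iff: "w \<in> W \<Longrightarrow> w x = w y \<longleftrightarrow> x = y"
  using weyl_inv_apply by metis

lemma weyl_coroot: "w \<in> W \<Longrightarrow> coroot (w \<alpha>) = w (coroot \<alpha>)"
  by (simp add: coroot_orthogonal weyl_orthogonal)

lemma weyl_coroot_inner: "w \<in> W \<Longrightarrow> coroot (w \<alpha>) \<bullet> w x = coroot \<alpha> \<bullet> x"
  by (simp add: weyl_coroot)

lemma weyl_reflection_apply: "w \<in> W \<Longrightarrow> reflection (w \<alpha>) (w x) = w (reflection \<alpha> x)"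
  by (simp add: reflection_orthogonal weyl_orthogonal)

lemma weyl_reflection_comp: "w \<in> W \<Longrightarrow> reflection (w \<alpha>) \<circ> w = w \<circ> reflection \<alpha>"
  by (rule ext) (simp add: weyl_reflection_apply)

subsection \<open>Length and inversions\<close>

definition inversions :: "('a \<Rightarrow> 'a) \<Rightarrow> 'a set" where
  "inversions w = {\<beta> \<in> \<Phi>. 0 < ht \<beta> \<and> ht (w \<beta>) < 0}"

lemma finite_inversions: "finite (inversions w)"
  unfolding inversions_def using finite_roots by simp

text \<open>The reflection in \<alpha> permutes the positive roots other than \<alpha>, so it
  carries the inversions of \<open>w\<close> to those of the product other than \<alpha>; the root
  \<alpha> is the one new inversion.\<close>

lemma inversions_simple_up:
  assumes "w \<in> W" "\<alpha> \<in> \<Delta>" "0 < ht (w \<alpha>)"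
  shows "card (inversions (w \<circ> reflection \<alpha>)) = Suc (card (inversions w))"
proof -
  have a: "\<alpha> \<in> \<Phi>" "0 < ht \<alpha>" using assms base_subset ht_base by auto
  have "inversions (w \<circ> reflection \<alpha>) = insert \<alpha> (reflection \<alpha> ` inversions w)"
  proof (intro equalityI subsetI)
    fix \<beta> assume b: "\<beta> \<in> inversions (w \<circ> reflection \<alpha>)"
    show "\<beta> \<in> insert \<alpha> (reflection \<alpha> ` inversions w)"
    proof (cases "\<beta> = \<alpha>")
      case False
      then have "reflection \<alpha> \<beta> \<in> inversions w"
        using b a simple_reflection_pos[OF assms(2)] reflection_root unfolding inversions_def by auto
      then have "reflection \<alpha> (reflection \<alpha> \<beta>) \<in> reflection \<alpha> ` inversions w" by blast
      then show ?thesis by simp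
    qed simp
  next
    fix \<beta> assume b: "\<beta> \<in> insert \<alpha> (reflection \<alpha> ` inversions w)"
    show "\<beta> \<in> inversions (w \<circ> reflection \<alpha>)"
    proof (cases "\<beta> = \<alpha>")
      case True
      then show ?thesis using assms a unfolding inversions_def
        by (simp add: reflection_self root_nonzero weyl_uminus)
    next
      case False
      then obtain \<gamma> where "\<gamma> \<in> inversions w" "\<beta> = reflection \<alpha> \<gamma>" using b by blast
      moreover from this have "\<gamma> \<noteq> \<alpha>" using assms unfolding inversions_def by auto
      ultimately show ?thesis using a reflection_root simple_reflection_pos[OF assms(2)]
        unfolding inversions_def by auto
    qed
  qed
  moreover have "\<alpha> \<notin> reflection \<alpha> ` inversions w"
  proof
    assume "\<alpha> \<in> reflection \<alpha> ` inversions w"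
    then obtain \<gamma> where "\<gamma> \<in> inversions w" "\<alpha> = reflection \<alpha> \<gamma>" by blast
    then have "\<gamma> = - \<alpha>" using reflection_self[of \<alpha>] a root_nonzero reflection_reflection by metis
    then show False using \<open>\<gamma> \<in> inversions w\<close> a unfolding inversions_def by simp
  qed
  moreover have "inj_on (reflection \<alpha>) (inversions w)"
    by (metis inj_onI reflection_reflection)
  ultimately show ?thesis using finite_inversions by (simp add: card_image)
qed

lemma inversions_simple_down:
  assumes "w \<in> W" "\<alpha> \<in> \<Delta>" "ht (w \<alpha>) < 0"
  shows "Suc (card (inversions (w \<circ> reflection \<alpha>))) = card (inversions w)"
proof -
  have "\<alpha> \<in> \<Phi>" using assms base_subset by blast
  then have "0 < ht ((w \<circ> reflection \<alpha>) \<alpha>)" "w \<circ> reflection \<alpha> \<in> W"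
    using assms by (simp_all add: reflection_self root_nonzero weyl_uminus weyl_comp weyl_reflection)
  from inversions_simple_up[OF this(2) assms(2) this(1)]
  show ?thesis by (simp only: comp_reflection_cancel)
qed

section \<open>Words in simple reflections, exchange and reduced words\<close>

abbreviation simple_words :: "'a list set" where
  "simple_words \<equiv> {as. set as \<subseteq> \<Delta>}"

lemma refl_word_simple_weyl: "as \<in> simple_words \<Longrightarrow> refl_word as \<in> W"
  unfolding weyl_group_def using base_subset by blast

text \<open>Otherwise expanding one factor of \<beta> \<bullet> \<beta> in the base would give a
  nonpositive number. Reflecting in the resulting \<alpha> lowers the height of \<beta>.\<close>

lemma pos_root_inner_simple:
  assumes "\<beta> \<in> \<Phi>" "0 < ht \<beta>"
  obtains \<alpha> where "\<alpha> \<in> \<Delta>" "0 < \<alpha> \<bullet> \<beta>"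
proof -
  have "\<not> (\<forall>\<delta>\<in>\<Delta>. \<delta> \<bullet> \<beta> \<le> 0)"
  proof
    assume "\<forall>\<delta>\<in>\<Delta>. \<delta> \<bullet> \<beta> \<le> 0"
    then have "0 \<le> - (\<beta> \<bullet> \<beta>)"
      using pos_root_nonneg[OF assms, of "\<lambda>x. - (x \<bullet> \<beta>)"]
      by (simp add: linear_compose_neg bounded_linear.linear[OF bounded_linear_inner_left])
    then show False using root_nonzero[OF assms(1)] inner_ge_zero[of \<beta>] by auto
  qed
  then show thesis using that by force
qed

text \<open>Conjugation by a simple reflection replaces \<beta> by a root of smaller height. Since
  \<open>ht\<close> is real-valued, the induction runs on the number of roots of smaller
  height.\<close>

lemma reflection_simple_word:
  assumes "\<beta> \<in> \<Phi>" "0 < ht \<beta>"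
  shows "reflection \<beta> \<in> refl_word ` simple_words"
  using assms
proof (induction "card {\<gamma> \<in> \<Phi>. ht \<gamma> < ht \<beta>}" arbitrary: \<beta> rule: less_induct)
  case less
  show ?case
  proof (cases "\<beta> \<in> \<Delta>")
    case True
    then show ?thesis by (intro image_eqI[of _ _ "[\<beta>]"]) auto
  next
    case False
    obtain \<alpha> where \<alpha>: "\<alpha> \<in> \<Delta>" "0 < \<alpha> \<bullet> \<beta>"
      using pos_root_inner_simple less.prems by blast
    then have a: "\<alpha> \<in> \<Phi>" using base_subset by blast
    let ?\<beta> = "reflection \<alpha> \<beta>"
    have r: "?\<beta> \<in> \<Phi>" "0 < ht ?\<beta>"
      using simple_reflection_pos[OF \<alpha>(1)] False \<alpha> a less.prems reflection_root by auto
    have lt: "ht ?\<beta> < ht \<beta>"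
      using \<alpha> a by (simp add: reflection_def ht_base coroot_inner_pos_iff root_nonzero)
    have "{\<gamma> \<in> \<Phi>. ht \<gamma> < ht ?\<beta>} \<subset> {\<gamma> \<in> \<Phi>. ht \<gamma> < ht \<beta>}"
      using lt r by (intro psubsetI) force+
    then have "card {\<gamma> \<in> \<Phi>. ht \<gamma> < ht ?\<beta>} < card {\<gamma> \<in> \<Phi>. ht \<gamma> < ht \<beta>}"
      using finite_roots by (intro psubset_card_mono) auto
    from less.hyps[OF this r] obtain as where as: "set as \<subseteq> \<Delta>" "reflection ?\<beta> = refl_word as"
      by auto
    have "reflection \<beta> = reflection \<alpha> \<circ> reflection ?\<beta> \<circ> reflection \<alpha>"
      using weyl_reflection_comp[OF weyl_reflection[OF a], of ?\<beta>]
      by (simp add: comp_assoc flip: weyl_reflection_comp[OF weyl_reflection[OF a]])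
    then have "reflection \<beta> = refl_word (\<alpha> # as @ [\<alpha>])"
      using as by (simp add: refl_word_append comp_assoc)
    then show ?thesis using as \<alpha> by (intro image_eqI[of _ _ "\<alpha> # as @ [\<alpha>]"]) auto
  qed
qed

text \<open>\<open>weyl_group\<close> is generated by all root reflections while \<open>len\<close>
  counts simple ones; this ensures that the minimum in \<open>len\<close> is taken over a nonempty
  set.\<close>

lemma weyl_simple_word: "w \<in> W \<Longrightarrow> w \<in> refl_word ` simple_words"
proof -
  have "set as \<subseteq> \<Phi> \<Longrightarrow> refl_word as \<in> refl_word ` simple_words" for as
  proof (induction as)
    case Nil
    then show ?case by (intro image_eqI[of _ _ "[]"]) auto
  next
    case (Cons a as)
    then obtain bs where bs: "set bs \<subseteq> \<Delta>" "refl_word as = refl_word bs" by auto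
    have "reflection a \<in> refl_word ` simple_words"
    proof (cases "0 < ht a")
      case False
      then show ?thesis using reflection_simple_word[of "- a"] Cons.prems root_ht_cases[of a]
        by (auto simp: reflection_uminus uminus_root)
    qed (use reflection_simple_word Cons.prems in auto)
    then obtain cs where "set cs \<subseteq> \<Delta>" "reflection a = refl_word cs" by auto
    then show ?case using bs
      by (intro image_eqI[of _ _ "cs @ bs"]) (auto simp: refl_word_append)
  qed
  then show "w \<in> W \<Longrightarrow> w \<in> refl_word ` simple_words"
    unfolding weyl_group_def by auto
qed

text \<open>Applying the letters to \<alpha> from the right, the image turns negative at some letter
  \<open>a\<close>. A simple reflection makes only its own positive root negative, so the image just
  before is \<open>a\<close> itself, and deleting this letter amounts to multiplying by the
  reflection in \<alpha> on the right.\<close>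

lemma exchange:
  assumes "set as \<subseteq> \<Delta>" "\<alpha> \<in> \<Delta>" "ht (refl_word as \<alpha>) < 0"
  shows "\<exists>bs. set bs \<subseteq> \<Delta> \<and> Suc (length bs) = length as \<and>
    refl_word bs = refl_word as \<circ> reflection \<alpha>"
  using assms
proof (induction as)
  case Nil
  then show ?case by (simp add: ht_base)
next
  case (Cons a as)
  let ?w = "refl_word as"
  have w: "?w \<in> W" using Cons.prems refl_word_simple_weyl by simp
  have r: "?w \<alpha> \<in> \<Phi>" using Cons.prems base_subset weyl_root[OF w] by blast
  show ?case
  proof (cases "ht (?w \<alpha>) < 0")
    case True
    with Cons obtain bs where "set bs \<subseteq> \<Delta>" "Suc (length bs) = length as"
      "refl_word bs = ?w \<circ> reflection \<alpha>" by (metis insert_subset list.set(2))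
    then show ?thesis using Cons.prems by (intro exI[of _ "a # bs"]) (simp add: comp_assoc)
  next
    case False
    then have "?w \<alpha> = a"
      using simple_reflection_pos[of a "?w \<alpha>"] Cons.prems r root_ht_cases[OF r] by force
    then have "refl_word (a # as) \<circ> reflection \<alpha> = ?w"
      using weyl_reflection_comp[OF w, of \<alpha>] by (simp add: comp_assoc)
    then have "refl_word as = refl_word (a # as) \<circ> reflection \<alpha>" by (rule sym)
    moreover have "set as \<subseteq> \<Delta>" "Suc (length as) = length (a # as)" using Cons.prems by auto
    ultimately show ?thesis by blast
  qed
qed

lemma card_inversions_le: "set as \<subseteq> \<Delta> \<Longrightarrow> card (inversions (refl_word as)) \<le> length as"
proof (induction as rule: rev_induct)
  case Nil
  then show ?case by (simp add: inversions_def not_less[THEN iffD2, OF less_imp_le] cong: conj_cong)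
next
  case (snoc a as)
  let ?w = "refl_word as"
  have w: "?w \<in> W" using snoc.prems refl_word_simple_weyl by simp
  have a: "a \<in> \<Delta>" "w \<in> W \<Longrightarrow> w a \<in> \<Phi>" for w using snoc.prems base_subset weyl_root by auto
  have "card (inversions ?w) \<le> length as" using snoc by simp
  then show ?case
    using inversions_simple_up[OF w a(1)] inversions_simple_down[OF w a(1)]
      root_ht_cases[OF a(2)[OF w]]
    by (auto simp: refl_word_snoc simp del: comp_apply)
qed

text \<open>The word is built up letter by letter: a letter that adds an inversion is appended, and
  one that removes an inversion is absorbed by \<open>exchange\<close>, which deletes a letter from
  the reduced word found so far.\<close>

lemma reduced_word: "set as \<subseteq> \<Delta> \<Longrightarrow>
  \<exists>bs. set bs \<subseteq> \<Delta> \<and> refl_word bs = refl_word as \<and> length bs = card (inversions (refl_word as))"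
proof (induction as rule: rev_induct)
  case Nil
  then show ?case by (intro exI[of _ "[]"]) (simp add: inversions_def not_less[THEN iffD2, OF less_imp_le] cong: conj_cong)
next
  case (snoc a as)
  then obtain bs where bs: "set bs \<subseteq> \<Delta>" "refl_word bs = refl_word as"
    "length bs = card (inversions (refl_word as))" by auto
  let ?w = "refl_word as"
  have w: "?w \<in> W" using snoc.prems refl_word_simple_weyl by simp
  have a: "a \<in> \<Delta>" "w \<in> W \<Longrightarrow> w a \<in> \<Phi>" for w using snoc.prems base_subset weyl_root by auto
  consider "0 < ht (?w a)" | "ht (?w a) < 0" using root_ht_cases[OF a(2)[OF w]] by blast
  then show ?case
  proof cases
    case 1
    then show ?thesis using inversions_simple_up[OF w a(1)] bs a
      by (intro exI[of _ "bs @ [a]"]) (simp add: refl_word_snoc del: comp_apply)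
  next
    case 2
    then obtain cs where "set cs \<subseteq> \<Delta>" "Suc (length cs) = length bs"
      "refl_word cs = refl_word bs \<circ> reflection a"
      using exchange[of bs a] bs a by auto
    then show ?thesis using inversions_simple_down[OF w a(1)] 2 bs
      by (intro exI[of _ cs]) (simp add: refl_word_snoc del: comp_apply)
  qed
qed

lemma len_eq:
  assumes "w \<in> W" shows "len \<Delta> w = card (inversions w)"
  unfolding len_def
proof (rule Least_equality)
  show "\<exists>as. set as \<subseteq> \<Delta> \<and> length as = card (inversions w) \<and> refl_word as = w"
    using weyl_simple_word[OF assms] reduced_word by fastforce
qed (use card_inversions_le in auto)

lemma no_inversions:
  assumes "w \<in> W" "inversions w = {}" shows "w = id"
  using weyl_simple_word[OF assms(1)] reduced_word assms by fastforce

text \<open>The map \<open>f\<close> injects the inversions of \<open>w\<close> into those of the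
  product and misses \<beta>. It reflects a root whenever the result stays positive and fixes it
  otherwise; in the second case the pairing of \<open>y\<close> with the coroot of \<beta> is
  nonnegative, so subtracting that multiple of w \<beta> > 0 from w y < 0 keeps the image
  negative.\<close>

lemma len_reflection_less:
  assumes "w \<in> W" "\<beta> \<in> \<Phi>" "0 < ht \<beta>" "0 < ht (w \<beta>)"
  shows "len \<Delta> w < len \<Delta> (w \<circ> reflection \<beta>)"
proof -
  let ?t = "reflection \<beta>"
  define f where "f \<gamma> = (if 0 < ht (?t \<gamma>) then ?t \<gamma> else \<gamma>)" for \<gamma>
  have t\<beta>: "?t \<beta> = - \<beta>" using assms by (simp add: reflection_self root_nonzero)
  have "inj_on f (inversions w)"
  proof (rule inj_onI)
    fix x y assume "x \<in> inversions w" "y \<in> inversions w" "f x = f y"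
    then show "x = y" unfolding f_def inversions_def
      by (auto split: if_splits) (metis reflection_reflection)+
  qed
  then have c: "card (f ` inversions w) = card (inversions w)" by (rule card_image)
  have im: "f ` inversions w \<subseteq> inversions (w \<circ> ?t)"
  proof
    fix x assume "x \<in> f ` inversions w"
    then obtain y where y: "y \<in> \<Phi>" "0 < ht y" "ht (w y) < 0" "x = f y"
      unfolding inversions_def by blast
    show "x \<in> inversions (w \<circ> ?t)"
    proof (cases "0 < ht (?t y)")
      case True
      then show ?thesis using y assms unfolding f_def inversions_def by (simp add: reflection_root)
    next
      case False
      then have "0 \<le> coroot \<beta> \<bullet> y * ht \<beta>" using y by (simp add: reflection_def)
      then have "0 \<le> coroot \<beta> \<bullet> y" using assms by (simp add: zero_le_mult_iff)
      then have "ht (w (?t y)) < 0" using y assms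
        by (simp add: reflection_def weyl_diff weyl_scale add_neg_nonpos diff_less_eq)
           (smt (verit) mult_nonneg_nonneg)
      then show ?thesis using y False unfolding f_def inversions_def by simp
    qed
  qed
  have "\<beta> \<notin> f ` inversions w"
  proof
    assume "\<beta> \<in> f ` inversions w"
    then obtain y where y: "y \<in> \<Phi>" "0 < ht y" "ht (w y) < 0" "\<beta> = f y"
      unfolding inversions_def by blast
    then have "f y = ?t y" using assms unfolding f_def by (auto split: if_splits)
    then have "\<beta> = ?t y" using y by simp
    then have "y = - \<beta>" using t\<beta> by (metis reflection_reflection)
    then have "ht y = - ht \<beta>" by (metis ht_simps(3))
    then show False using y(2) assms by simp
  qed
  moreover have "\<beta> \<in> inversions (w \<circ> ?t)"
    using assms t\<beta> unfolding inversions_def by (simp add: weyl_uminus)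
  ultimately have "f ` inversions w \<subset> inversions (w \<circ> ?t)" using im by blast
  from psubset_card_mono[OF finite_inversions this] show ?thesis
    using c assms by (simp add: len_eq weyl_comp weyl_reflection)
qed

lemma len_reflection_greater:
  assumes "w \<in> W" "\<beta> \<in> \<Phi>" "0 < ht \<beta>" "ht (w \<beta>) < 0"
  shows "len \<Delta> (w \<circ> reflection \<beta>) < len \<Delta> w"
proof -
  have "len \<Delta> (w \<circ> reflection \<beta>) < len \<Delta> (w \<circ> reflection \<beta> \<circ> reflection \<beta>)"
    using assms by (intro len_reflection_less)
      (auto simp: weyl_comp weyl_reflection reflection_self root_nonzero weyl_uminus)
  then show ?thesis by simp
qed

lemma len_less_reflection_iff:
  assumes "w \<in> W" "\<beta> \<in> \<Phi>" "0 < ht \<beta>"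
  shows "len \<Delta> w < len \<Delta> (w \<circ> reflection \<beta>) \<longleftrightarrow> 0 < ht (w \<beta>)"
  using len_reflection_less len_reflection_greater root_ht_cases[OF weyl_root] assms
  by (meson less_asym)

lemma len_simple_right:
  assumes "w \<in> W" "\<alpha> \<in> \<Delta>"
  shows "len \<Delta> (w \<circ> reflection \<alpha>) = Suc (len \<Delta> w) \<and> 0 < ht (w \<alpha>) \<or>
    Suc (len \<Delta> (w \<circ> reflection \<alpha>)) = len \<Delta> w \<and> ht (w \<alpha>) < 0"
proof -
  have "\<alpha> \<in> \<Phi>" using assms base_subset by blast
  then show ?thesis
  using inversions_simple_up[OF assms] inversions_simple_down[OF assms] root_ht_cases[OF weyl_root]
    assms by (auto simp: len_eq weyl_comp weyl_reflection)
qed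

text \<open>Transfers statements about right multiplication by a simple reflection to left
  multiplication. The inversions of the two elements correspond under \<beta> \<mapsto> - w
  \<beta>.\<close>

lemma len_inv:
  assumes "w \<in> W" shows "len \<Delta> (inv w) = len \<Delta> w"
proof -
  have "inversions (inv w) = (\<lambda>\<beta>. - w \<beta>) ` inversions w"
  proof (intro equalityI subsetI)
    fix \<beta> assume "\<beta> \<in> inversions (inv w)"
    then have "- inv w \<beta> \<in> inversions w" "\<beta> = - w (- inv w \<beta>)"
      using assms weyl_root[OF weyl_inv[OF assms]] unfolding inversions_def
      by (auto simp: weyl_uminus uminus_root)
    then show "\<beta> \<in> (\<lambda>\<beta>. - w \<beta>) ` inversions w" by (rule rev_image_eqI)
  qed (use assms weyl_root in \<open>auto simp: inversions_def weyl_uminus weyl_inv uminus_root\<close>)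
  moreover have "inj_on (\<lambda>\<beta>. - w \<beta>) (inversions w)"
    using weyl_eq_iff[OF assms] by (auto intro: inj_onI)
  ultimately show ?thesis using assms by (simp add: len_eq weyl_inv card_image)
qed

lemma inv_comp_reflection: "v \<in> W \<Longrightarrow> inv (reflection \<alpha> \<circ> v) = inv v \<circ> reflection \<alpha>"
  by (rule inv_unique_comp) (auto simp: fun_eq_iff)

lemma len_simple_left:
  assumes "v \<in> W" "\<alpha> \<in> \<Delta>"
  shows "len \<Delta> (reflection \<alpha> \<circ> v) = Suc (len \<Delta> v) \<and> 0 < ht (inv v \<alpha>) \<or>
    Suc (len \<Delta> (reflection \<alpha> \<circ> v)) = len \<Delta> v \<and> ht (inv v \<alpha>) < 0"
proof -
  have "reflection \<alpha> \<circ> v \<in> W" using assms base_subset by (auto intro: weyl_comp weyl_reflection)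
  then show ?thesis
    using len_simple_right[OF weyl_inv[OF assms(1)] assms(2)] assms
    by (simp add: len_inv flip: inv_comp_reflection)
qed

subsection \<open>Bruhat covers\<close>

lemma reflection_pos_root:
  assumes "\<beta> \<in> \<Phi>"
  obtains \<beta>' where "\<beta>' \<in> \<Phi>" "0 < ht \<beta>'" "reflection \<beta>' = reflection \<beta>" "\<beta>' = \<beta> \<or> \<beta>' = - \<beta>"
  using that[of \<beta>] that[of "- \<beta>"] root_ht_cases[OF assms] assms
  by (auto simp: reflection_uminus uminus_root)

definition step :: "('a \<Rightarrow> 'a) \<Rightarrow> ('a \<Rightarrow> 'a) \<Rightarrow> bool" where
  "step u v \<longleftrightarrow> u \<in> W \<and> (\<exists>\<beta>\<in>\<Phi>. v = u \<circ> reflection \<beta>) \<and> len \<Delta> u < len \<Delta> v"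

lemma bruhat_less_step: "bruhat_less \<Phi> \<Delta> = step\<^sup>+\<^sup>+"
  unfolding bruhat_less_def step_def ..

lemma step_weyl: "step u v \<Longrightarrow> u \<in> W \<and> v \<in> W"
  unfolding step_def by (auto simp: weyl_comp weyl_reflection)

lemma bruhat_less_weyl: "bruhat_less \<Phi> \<Delta> u v \<Longrightarrow> u \<in> W \<and> v \<in> W"
  unfolding bruhat_less_step by (induction rule: tranclp_induct) (auto dest: step_weyl)

lemma bruhat_less_len: "bruhat_less \<Phi> \<Delta> u v \<Longrightarrow> len \<Delta> u < len \<Delta> v"
  unfolding bruhat_less_step by (induction rule: tranclp_induct) (auto simp: step_def)

lemma bruhat_less_trans:
  "bruhat_less \<Phi> \<Delta> u v \<Longrightarrow> bruhat_less \<Phi> \<Delta> v x \<Longrightarrow> bruhat_less \<Phi> \<Delta> u x"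
  unfolding bruhat_less_step by (rule tranclp_trans)

lemma bruhat_less_reflection:
  assumes "u \<in> W" "\<beta> \<in> \<Phi>" "0 < ht \<beta>" "0 < ht (u \<beta>)"
  shows "bruhat_less \<Phi> \<Delta> u (u \<circ> reflection \<beta>)"
  using assms len_reflection_less unfolding bruhat_less_step step_def by blast

text \<open>Multiplying both ends by the simple reflection turns a step along \<beta> into one along
  the reflected root, which is again positive unless \<beta> = \<alpha>; in that exceptional case
  the step itself is multiplication by the reflection in \<alpha>.\<close>

lemma step_simple_lift:
  assumes "step u v" "\<alpha> \<in> \<Delta>"
  shows "u \<circ> reflection \<alpha> = v \<or> bruhat_less \<Phi> \<Delta> (u \<circ> reflection \<alpha>) (v \<circ> reflection \<alpha>)"
proof -
  obtain \<gamma> where "u \<in> W" "\<gamma> \<in> \<Phi>" "v = u \<circ> reflection \<gamma>" "len \<Delta> u < len \<Delta> v"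
    using assms unfolding step_def by blast
  then obtain \<beta> where u: "u \<in> W" and b: "\<beta> \<in> \<Phi>" "0 < ht \<beta>" "v = u \<circ> reflection \<beta>"
    "len \<Delta> u < len \<Delta> v"
    using reflection_pos_root[of \<gamma>] by metis
  then have ub: "0 < ht (u \<beta>)" using len_less_reflection_iff by blast
  have a: "\<alpha> \<in> \<Phi>" using assms base_subset by blast
  show ?thesis
  proof (cases "\<beta> = \<alpha>")
    case False
    let ?r = "reflection \<alpha>"
    have "bruhat_less \<Phi> \<Delta> (u \<circ> ?r) (u \<circ> ?r \<circ> reflection (?r \<beta>))"
      using u b ub a False assms
      by (intro bruhat_less_reflection)
        (auto simp: weyl_comp weyl_reflection reflection_root simple_reflection_pos)
    moreover have "u \<circ> ?r \<circ> reflection (?r \<beta>) = v \<circ> ?r"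
      using weyl_reflection_comp[OF weyl_reflection[OF a], of "?r \<beta>"] b by (simp add: comp_assoc)
    ultimately show ?thesis by simp
  qed (use b in simp)
qed

text \<open>A form of the lifting property. The steps of a chain are multiplied on the right by the
  simple reflection until one of them is multiplication by that reflection; from there the original
  chain is followed.\<close>

lemma bruhat_less_simple_lift:
  assumes "bruhat_less \<Phi> \<Delta> u v" "\<alpha> \<in> \<Delta>"
  shows "u \<circ> reflection \<alpha> = v \<or> bruhat_less \<Phi> \<Delta> (u \<circ> reflection \<alpha>) v \<or>
    bruhat_less \<Phi> \<Delta> (u \<circ> reflection \<alpha>) (v \<circ> reflection \<alpha>)"
  using assms(1) unfolding bruhat_less_step
proof (induction rule: tranclp_induct)
  case (base v)
  then show ?case using step_simple_lift[OF _ assms(2)] unfolding bruhat_less_step by blast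
next
  case (step v x)
  have "v \<circ> reflection \<alpha> = x \<or> step\<^sup>+\<^sup>+ (v \<circ> reflection \<alpha>) (x \<circ> reflection \<alpha>)"
    using step_simple_lift[OF step.hyps(2) assms(2)] unfolding bruhat_less_step .
  with step.IH show ?case
    using step.hyps(2) by (auto intro: tranclp.intros tranclp_trans simp del: comp_apply)
qed

text \<open>A reflection that raises the length by more than one is not a cover. A simple root
  \<alpha> sent to a negative root by the upper element v gives v r_\<alpha> < v. If u \<alpha> > 0,
  then u < u r_\<alpha> < v r_\<alpha> < v. Otherwise u r_\<alpha> is shorter than u, the induction
  hypothesis supplies an element between u r_\<alpha> and v r_\<alpha>, and the lifting property
  carries it to one between u and v.\<close>

lemma bruhat_between:
  assumes "u \<in> W" "\<beta> \<in> \<Phi>" "0 < ht \<beta>" "0 < ht (u \<beta>)"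
    "len \<Delta> (u \<circ> reflection \<beta>) \<noteq> Suc (len \<Delta> u)"
  shows "\<exists>x. bruhat_less \<Phi> \<Delta> u x \<and> bruhat_less \<Phi> \<Delta> x (u \<circ> reflection \<beta>)"
  using assms
proof (induction "len \<Delta> (u \<circ> reflection \<beta>)" arbitrary: u \<beta> rule: less_induct)
  case less
  let ?v = "u \<circ> reflection \<beta>"
  have b: "\<beta> \<in> \<Phi>" and u: "u \<in> W" using less.prems by blast+
  have v: "?v \<in> W" using u b weyl_comp weyl_reflection by blast
  \<comment> \<open>If no simple root became negative, \<open>?v\<close> would send \<beta> to
    something of nonnegative height, but it sends \<beta> to - u \<beta>.\<close>
  have "\<exists>\<alpha>\<in>\<Delta>. ht (?v \<alpha>) < 0"
  proof (rule ccontr)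
    assume "\<not> ?thesis"
    then have "0 \<le> ht (?v \<beta>)"
      using pos_root_nonneg[OF b less.prems(3) linear_compose[OF weyl_linear[OF v] linear_ht]] by force
    then show False using less.prems b u by (simp add: reflection_self root_nonzero weyl_uminus)
  qed
  then obtain \<alpha> where \<alpha>: "\<alpha> \<in> \<Delta>" "ht (?v \<alpha>) < 0" by blast
  let ?s = "reflection \<alpha>"
  have a: "\<alpha> \<in> \<Phi>" "0 < ht \<alpha>" using \<alpha> base_subset ht_base by auto
  have vs: "Suc (len \<Delta> (?v \<circ> ?s)) = len \<Delta> ?v" using len_simple_right[OF v \<alpha>(1)] \<alpha> by auto
  have vs_v: "bruhat_less \<Phi> \<Delta> (?v \<circ> ?s) ?v"
    using bruhat_less_reflection[of "?v \<circ> ?s" \<alpha>] v a \<alpha>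
    by (simp add: weyl_comp weyl_reflection reflection_self root_nonzero weyl_uminus[OF v])
      (metis weyl_uminus[OF v] comp_apply ht_simps(3) neg_0_less_iff_less u weyl_comp weyl_reflection)
  have ne: "\<beta> \<noteq> \<alpha>" using vs less.prems(5) by auto
  have us: "u \<circ> ?s \<in> W" using u a weyl_comp weyl_reflection by blast
  have sb: "?s \<beta> \<in> \<Phi>" "0 < ht (?s \<beta>)" "0 < ht ((u \<circ> ?s) (?s \<beta>))"
    using simple_reflection_pos[OF \<alpha>(1)] ne less.prems a reflection_root by auto
  have eq: "u \<circ> ?s \<circ> reflection (?s \<beta>) = ?v \<circ> ?s"
    using weyl_reflection_comp[OF weyl_reflection[OF a(1)], of "?s \<beta>"] by (simp add: comp_assoc)
  have us_vs: "bruhat_less \<Phi> \<Delta> (u \<circ> ?s) (?v \<circ> ?s)"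
    using bruhat_less_reflection[OF us sb] unfolding eq .
  show ?case
  proof (cases "0 < ht (u \<alpha>)")
    case True
    then show ?thesis
      using bruhat_less_reflection[OF u a] us_vs vs_v bruhat_less_trans by blast
  next
    case False
    then have lu: "Suc (len \<Delta> (u \<circ> ?s)) = len \<Delta> u" using len_simple_right[OF u \<alpha>(1)] by blast
    have "\<exists>x. bruhat_less \<Phi> \<Delta> (u \<circ> ?s) x \<and> bruhat_less \<Phi> \<Delta> x (u \<circ> ?s \<circ> reflection (?s \<beta>))"
      by (rule less.hyps[OF _ us sb]) (use vs lu less.prems(5) eq in \<open>auto simp del: comp_apply\<close>)
    then obtain x where x: "bruhat_less \<Phi> \<Delta> (u \<circ> ?s) x" "bruhat_less \<Phi> \<Delta> x (?v \<circ> ?s)"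
      unfolding eq by blast
    have xW: "x \<in> W" using bruhat_less_weyl x by blast
    have xv: "bruhat_less \<Phi> \<Delta> x ?v" using x(2) vs_v bruhat_less_trans by blast
    have "len \<Delta> x < len \<Delta> (?v \<circ> ?s)" using x bruhat_less_len by blast
    then have lxs: "len \<Delta> (x \<circ> ?s) < len \<Delta> ?v"
      using len_simple_right[OF xW \<alpha>(1)] vs by auto
    have "x \<circ> ?s = ?v \<circ> ?s \<or> bruhat_less \<Phi> \<Delta> (x \<circ> ?s) (?v \<circ> ?s) \<or>
      bruhat_less \<Phi> \<Delta> (x \<circ> ?s) (?v \<circ> ?s \<circ> ?s)"
      by (rule bruhat_less_simple_lift[OF x(2) \<alpha>(1)])
    then have xsv: "bruhat_less \<Phi> \<Delta> (x \<circ> ?s) ?v"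
      using vs_v bruhat_less_trans by auto
    \<comment> \<open>The three alternatives yield different intermediate elements between
      \<open>u\<close> and \<open>?v\<close>: respectively \<open>?v \<circ> ?s\<close>,
      \<open>x\<close>, and \<open>x \<circ> ?s\<close>.\<close>
    have "u = x \<or> bruhat_less \<Phi> \<Delta> u x \<or> bruhat_less \<Phi> \<Delta> u (x \<circ> ?s)"
      using bruhat_less_simple_lift[OF x(1) \<alpha>(1)] by simp
    then show ?thesis using xv xsv x(2) vs_v by blast
  qed
qed

text \<open>Replaces the Bruhat order by an equation between lengths; the sign of \<beta> does not
  matter because opposite roots have the same reflection.\<close>

lemma bruhat_covers_iff:
  assumes "u \<in> W" "\<beta> \<in> \<Phi>"
  shows "bruhat_covers \<Phi> \<Delta> (u \<circ> reflection \<beta>) u \<longleftrightarrow> len \<Delta> (u \<circ> reflection \<beta>) = Suc (len \<Delta> u)"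
proof -
  obtain \<gamma> where \<gamma>: "\<gamma> \<in> \<Phi>" "0 < ht \<gamma>" "reflection \<gamma> = reflection \<beta>"
    using reflection_pos_root[OF assms(2)] by metis
  have "bruhat_covers \<Phi> \<Delta> (u \<circ> reflection \<gamma>) u \<longleftrightarrow> len \<Delta> (u \<circ> reflection \<gamma>) = Suc (len \<Delta> u)"
  proof
    assume c: "bruhat_covers \<Phi> \<Delta> (u \<circ> reflection \<gamma>) u"
    then have "0 < ht (u \<gamma>)"
      using bruhat_less_len len_less_reflection_iff[OF assms(1) \<gamma>(1,2)]
      unfolding bruhat_covers_def by blast
    then show "len \<Delta> (u \<circ> reflection \<gamma>) = Suc (len \<Delta> u)"
      using bruhat_between[OF assms(1) \<gamma>(1,2)] c unfolding bruhat_covers_def by blast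
  next
    assume l: "len \<Delta> (u \<circ> reflection \<gamma>) = Suc (len \<Delta> u)"
    then have "0 < ht (u \<gamma>)" using len_less_reflection_iff[OF assms(1) \<gamma>(1,2)] by simp
    then have "bruhat_less \<Phi> \<Delta> u (u \<circ> reflection \<gamma>)"
      using bruhat_less_reflection assms \<gamma> by blast
    then show "bruhat_covers \<Phi> \<Delta> (u \<circ> reflection \<gamma>) u"
      unfolding bruhat_covers_def using l bruhat_less_len by (metis Suc_leI not_less)
  qed
  then show ?thesis unfolding \<gamma>(3) .
qed

end

subsection \<open>Minimal coset representatives\<close>

locale parabolic_root_system = based_root_system +
  fixes \<mu> :: "'a"
  assumes dominant: "dominant \<Delta> \<mu>"
begin

abbreviation "W\<^sub>J \<equiv> W_stab \<Phi> \<mu>"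

definition P :: "'a set" where
  "P = {\<beta> \<in> \<Phi>. 0 < \<beta> \<bullet> \<mu>}"

text \<open>This turns out to be the set of minimal representatives (\<open>min_reps_eq\<close>).
  The description by signs allows membership to be checked root by root.\<close>

definition M :: "('a \<Rightarrow> 'a) set" where
  "M = {w \<in> W. \<forall>\<beta>\<in>\<Phi>. \<beta> \<bullet> \<mu> = 0 \<longrightarrow> 0 < ht \<beta> \<longrightarrow> 0 < ht (w \<beta>)}"

text \<open>The length of the minimal representative of the coset of \<open>w\<close>
  (\<open>len_fl\<close>), but defined by any element of the coset, so that floors can be removed
  from length equations.\<close>

definition lenJ :: "('a \<Rightarrow> 'a) \<Rightarrow> nat" where
  "lenJ w = card {\<beta> \<in> P. ht (w \<beta>) < 0}"

text \<open>The vector 2\<rho> - 2\<rho>_J of the quantum edge condition, by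
  \<open>two_rho_diff\<close>.\<close>

definition S :: "'a" where
  "S = \<Sum>P"

lemma finite_P: "finite P"
  unfolding P_def using finite_roots by simp

lemma base_inner: "\<delta> \<in> \<Delta> \<Longrightarrow> 0 \<le> \<delta> \<bullet> \<mu>"
  using dominant base_subset root_nonzero coroot_inner_neg_iff[of \<delta> \<mu>]
  unfolding dominant_def by (meson not_less subsetD)

lemma linear_inner_left: "linear (\<lambda>x. x \<bullet> \<mu>)"
  by (rule bounded_linear.linear[OF bounded_linear_inner_left])

lemma pos_root_inner: "\<beta> \<in> \<Phi> \<Longrightarrow> 0 < ht \<beta> \<Longrightarrow> 0 \<le> \<beta> \<bullet> \<mu>"
  using pos_root_nonneg[OF _ _ linear_inner_left] base_inner by blast

lemma P_pos: "\<beta> \<in> P \<Longrightarrow> 0 < ht \<beta>"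
  using pos_root_inner[of "- \<beta>"] root_ht_cases[of \<beta>] unfolding P_def
  by (auto simp: uminus_root)

lemma P_root: "\<beta> \<in> P \<Longrightarrow> \<beta> \<in> \<Phi>"
  unfolding P_def by simp

lemma not_P: "\<beta> \<in> \<Phi> \<Longrightarrow> \<beta> \<notin> P \<Longrightarrow> \<beta> \<bullet> \<mu> \<le> 0"
  unfolding P_def by simp

lemma reflection_stab_iff: "\<beta> \<in> \<Phi> \<Longrightarrow> reflection \<beta> \<in> W\<^sub>J \<longleftrightarrow> \<beta> \<bullet> \<mu> = 0"
  unfolding W_stab_def
  by (auto simp: weyl_reflection reflection_def coroot_inner_eq_0_iff root_nonzero)

lemma pos_roots_stab_eq: "pos_roots_stab \<Phi> \<Delta> \<mu> = {\<beta> \<in> \<Phi>. 0 < ht \<beta> \<and> \<beta> \<bullet> \<mu> = 0}"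
  unfolding pos_roots_stab_def pos_roots_eq using reflection_stab_iff by auto

lemma P_eq: "pos_roots \<Phi> \<Delta> - pos_roots_stab \<Phi> \<Delta> \<mu> = P"
proof -
  have "\<beta> \<in> P \<longleftrightarrow> 0 < ht \<beta> \<and> \<beta> \<bullet> \<mu> \<noteq> 0" if "\<beta> \<in> \<Phi>" for \<beta>
    using that pos_root_inner[OF that] P_pos[of \<beta>] unfolding P_def by force
  then show ?thesis
    unfolding pos_roots_stab_eq pos_roots_eq using P_root by blast
qed

lemma two_rho_diff: "2 *\<^sub>R rho \<Phi> \<Delta> - 2 *\<^sub>R rho_stab \<Phi> \<Delta> \<mu> = S"
proof -
  have "pos_roots_stab \<Phi> \<Delta> \<mu> \<subseteq> pos_roots \<Phi> \<Delta>" "finite (pos_roots \<Phi> \<Delta>)"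
    using finite_roots unfolding pos_roots_stab_eq pos_roots_eq by auto
  then show ?thesis
    unfolding rho_def rho_stab_def S_def P_eq[symmetric] by (simp add: sum_diff)
qed

lemma stab_weyl: "u \<in> W\<^sub>J \<Longrightarrow> u \<in> W"
  and stab_fix: "u \<in> W\<^sub>J \<Longrightarrow> u \<mu> = \<mu>"
  unfolding W_stab_def by auto

lemma stab_inner: "u \<in> W\<^sub>J \<Longrightarrow> u \<beta> \<bullet> \<mu> = \<beta> \<bullet> \<mu>"
  using weyl_inner[of u \<beta> \<mu>] stab_weyl stab_fix by metis

lemma stab_inv: "u \<in> W\<^sub>J \<Longrightarrow> inv u \<in> W\<^sub>J"
  unfolding W_stab_def using weyl_inv weyl_inv_apply by (metis (mono_tags, lifting) mem_Collect_eq)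

lemma stab_comp: "u \<in> W\<^sub>J \<Longrightarrow> v \<in> W\<^sub>J \<Longrightarrow> u \<circ> v \<in> W\<^sub>J"
  unfolding W_stab_def by (auto simp: weyl_comp)

lemma stab_id: "id \<in> W\<^sub>J"
  unfolding W_stab_def by (auto simp: weyl_id)

lemma stab_P_iff: "u \<in> W\<^sub>J \<Longrightarrow> u \<beta> \<in> P \<longleftrightarrow> \<beta> \<in> P"
  unfolding P_def using stab_inner stab_weyl weyl_root weyl_inv stab_inv
  by (metis (no_types, lifting) mem_Collect_eq weyl_inv_apply(1))

lemma stab_image_P:
  assumes "u \<in> W\<^sub>J" shows "u ` P = P"
proof
  show "P \<subseteq> u ` P"
  proof
    fix \<beta> assume "\<beta> \<in> P"
    then have "inv u \<beta> \<in> P" using stab_P_iff[OF stab_inv[OF assms]] by blast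
    moreover have "u (inv u \<beta>) = \<beta>" using assms stab_weyl by simp
    ultimately show "\<beta> \<in> u ` P" by (metis imageI)
  qed
qed (use stab_P_iff[OF assms] in blast)

lemma weyl_inj_on: "w \<in> W \<Longrightarrow> inj_on w A"
  using weyl_eq_iff by (auto intro: inj_onI)

text \<open>The stabilizer permutes \<open>P\<close>. Consequently the quantum correction does not
  change when a label \<gamma> is replaced by z \<gamma> with z in W_J.\<close>

lemma stab_S:
  assumes "u \<in> W\<^sub>J" shows "u S = S"
proof -
  have "u S = sum u P"
    unfolding S_def using linear_sum[OF weyl_linear[OF stab_weyl[OF assms]]] by simp
  also have "\<dots> = \<Sum>(u ` P)"
    by (simp add: sum.reindex weyl_inj_on stab_weyl assms)
  finally show ?thesis unfolding S_def stab_image_P[OF assms] .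
qed

lemma M_weyl: "w \<in> M \<Longrightarrow> w \<in> W"
  unfolding M_def by simp

lemma M_pos: "w \<in> M \<Longrightarrow> \<beta> \<in> \<Phi> \<Longrightarrow> \<beta> \<bullet> \<mu> = 0 \<Longrightarrow> 0 < ht \<beta> \<Longrightarrow> 0 < ht (w \<beta>)"
  unfolding M_def by simp

lemma M_pos_iff: "w \<in> M \<Longrightarrow> \<beta> \<in> \<Phi> \<Longrightarrow> \<beta> \<bullet> \<mu> = 0 \<Longrightarrow> 0 < ht (w \<beta>) \<longleftrightarrow> 0 < ht \<beta>"
  using M_pos[of w \<beta>] M_pos[of w "- \<beta>"] root_ht_cases[of \<beta>]
  by (auto simp: uminus_root weyl_uminus M_weyl)

lemma lenJ_stab:
  assumes "u \<in> W\<^sub>J" shows "lenJ (v \<circ> u) = lenJ v"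
proof -
  have "{\<beta> \<in> P. ht (v \<beta>) < 0} = u ` {\<beta> \<in> P. ht ((v \<circ> u) \<beta>) < 0}"
    using stab_image_P[OF assms] by auto
  moreover have "inj_on u A" for A
    using weyl_eq_iff[OF stab_weyl[OF assms]] by (auto intro: inj_onI)
  ultimately show ?thesis unfolding lenJ_def by (simp add: card_image)
qed

lemma len_M: "w \<in> M \<Longrightarrow> len \<Delta> w = lenJ w"
proof -
  assume w: "w \<in> M"
  have "inversions w = {\<beta> \<in> P. ht (w \<beta>) < 0}"
  proof (intro equalityI subsetI)
    fix \<beta> assume "\<beta> \<in> inversions w"
    then have b: "\<beta> \<in> \<Phi>" "0 < ht \<beta>" "ht (w \<beta>) < 0" unfolding inversions_def by auto
    then have "\<beta> \<bullet> \<mu> \<noteq> 0" using M_pos[OF w b(1) _ b(2)] by fastforce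
    then show "\<beta> \<in> {\<beta> \<in> P. ht (w \<beta>) < 0}"
      using b pos_root_inner[OF b(1,2)] unfolding P_def by auto
  qed (use P_pos P_root in \<open>auto simp: inversions_def\<close>)
  then show ?thesis using w by (simp add: len_eq M_weyl lenJ_def)
qed

text \<open>The element \<open>u\<close> has no inversions. On roots orthogonal to \<mu> both
  \<open>w\<close> and \<open>w \<circ> u\<close> preserve signs, hence so does \<open>u\<close>;
  the other positive roots form \<open>P\<close>, which \<open>u\<close> permutes.\<close>

lemma stab_eq_id:
  assumes "w \<in> M" "u \<in> W\<^sub>J" "w \<circ> u \<in> M"
  shows "u = id"
proof (rule no_inversions)
  show "u \<in> W" using assms stab_weyl by blast
  have "0 < ht (u \<beta>)" if b: "\<beta> \<in> \<Phi>" "0 < ht \<beta>" for \<beta>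
  proof (cases "\<beta> \<bullet> \<mu> = 0")
    case True
    have "0 < ht (w (u \<beta>))" using M_pos[OF assms(3) b(1) True b(2)] by simp
    moreover have "u \<beta> \<in> \<Phi>" "u \<beta> \<bullet> \<mu> = 0"
      using b True assms stab_inner stab_weyl weyl_root by auto
    ultimately show ?thesis using M_pos_iff[OF assms(1)] by blast
  next
    case False
    then have "\<beta> \<in> P" using b pos_root_inner[OF b] unfolding P_def by simp
    then show ?thesis using P_pos stab_P_iff assms by blast
  qed
  then show "inversions u = {}" unfolding inversions_def by force
qed

text \<open>If a positive root of the stabilizer became negative, multiplying by its reflection
  would shorten the element without leaving the coset.\<close>

lemma is_min_rep_M:
  assumes "v \<in> W" "is_min_rep \<Phi> \<Delta> \<mu> v x" shows "x \<in> M"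
proof -
  obtain u where u: "u \<in> W\<^sub>J" "x = v \<circ> u"
    using assms(2) unfolding is_min_rep_def by blast
  have x: "x \<in> W" using u assms stab_weyl weyl_comp by blast
  have "0 < ht (x \<beta>)" if b: "\<beta> \<in> \<Phi>" "0 < ht \<beta>" "\<beta> \<bullet> \<mu> = 0" for \<beta>
  proof (rule ccontr)
    assume "\<not> ?thesis"
    then have "len \<Delta> (x \<circ> reflection \<beta>) < len \<Delta> x"
      using len_reflection_greater[OF x b(1,2)] root_ht_cases weyl_root x b by blast
    moreover have "x \<circ> reflection \<beta> \<in> (\<circ>) v ` W\<^sub>J"
      using u b reflection_stab_iff stab_comp by (metis comp_assoc image_eqI)
    ultimately show False using assms(2) unfolding is_min_rep_def by (meson not_less)
  qed
  then show ?thesis using x unfolding M_def by blast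
qed

lemma is_min_rep_exists: "\<exists>x. is_min_rep \<Phi> \<Delta> \<mu> v x"
proof -
  have "v \<circ> id \<in> (\<circ>) v ` W\<^sub>J" using stab_id by blast
  from ex_has_least_nat[of "\<lambda>x. x \<in> (\<circ>) v ` W\<^sub>J", OF this, of "len \<Delta>"]
  show ?thesis unfolding is_min_rep_def by auto
qed

lemma M_coset_unique:
  assumes "v \<circ> u \<in> M" "v \<circ> u' \<in> M" "u \<in> W\<^sub>J" "u' \<in> W\<^sub>J"
  shows "v \<circ> u = v \<circ> u'"
proof -
  have e: "u \<circ> (inv u \<circ> u') = u'" using assms stab_weyl by (auto simp: fun_eq_iff)
  then have "v \<circ> u \<circ> (inv u \<circ> u') = v \<circ> u'" by (simp only: comp_assoc)
  then have "inv u \<circ> u' = id"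
    using stab_eq_id[of "v \<circ> u" "inv u \<circ> u'"] assms stab_comp stab_inv by metis
  then show ?thesis using e by simp
qed

text \<open>A coset has a shortest element, every shortest element lies in \<open>M\<close>, and by
  \<open>M_coset_unique\<close> the coset meets \<open>M\<close> only once. This also provides the
  uniqueness behind the \<open>THE\<close> in \<open>min_rep\<close>.\<close>

lemma is_min_rep_iff:
  assumes "v \<in> W"
  shows "is_min_rep \<Phi> \<Delta> \<mu> v x \<longleftrightarrow> x \<in> M \<and> x \<in> (\<circ>) v ` W\<^sub>J"
proof
  assume x: "x \<in> M \<and> x \<in> (\<circ>) v ` W\<^sub>J"
  obtain y where y: "is_min_rep \<Phi> \<Delta> \<mu> v y" using is_min_rep_exists by blast
  then have "y \<in> M" "y \<in> (\<circ>) v ` W\<^sub>J"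
    using is_min_rep_M[OF assms] unfolding is_min_rep_def by auto
  then have "x = y" using x M_coset_unique by blast
  then show "is_min_rep \<Phi> \<Delta> \<mu> v x" using y by simp
qed (use is_min_rep_M[OF assms] in \<open>auto simp: is_min_rep_def\<close>)

section \<open>The floor map and the edges in terms of \<open>lenJ\<close>\<close>

abbreviation fl :: "('a \<Rightarrow> 'a) \<Rightarrow> 'a \<Rightarrow> 'a" where "fl \<equiv> min_rep \<Phi> \<Delta> \<mu>"

lemma fl_eqI:
  assumes "v \<in> W" "v \<circ> u \<in> M" "u \<in> W\<^sub>J"
  shows "fl v = v \<circ> u"
  unfolding min_rep_def
proof (rule the_equality)
  show "is_min_rep \<Phi> \<Delta> \<mu> v (v \<circ> u)" using assms is_min_rep_iff by blast
  show "x = v \<circ> u" if x: "is_min_rep \<Phi> \<Delta> \<mu> v x" for x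
  proof -
    from x obtain u' where "u' \<in> W\<^sub>J" "x = v \<circ> u'" "v \<circ> u' \<in> M"
      unfolding is_min_rep_iff[OF assms(1)] by blast
    then show ?thesis using M_coset_unique[OF _ assms(2) _ assms(3)] by simp
  qed
qed

lemma fl_obtain:
  assumes "v \<in> W"
  obtains u where "u \<in> W\<^sub>J" "fl v = v \<circ> u" "v \<circ> u \<in> M"
proof -
  obtain x where "is_min_rep \<Phi> \<Delta> \<mu> v x" using is_min_rep_exists by blast
  then obtain u where u: "u \<in> W\<^sub>J" "v \<circ> u \<in> M"
    unfolding is_min_rep_iff[OF assms] by blast
  show thesis using that[OF u(1) fl_eqI[OF assms u(2,1)] u(2)] .
qed

lemma fl_M: "v \<in> W \<Longrightarrow> fl v \<in> M"
  by (metis fl_obtain)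

lemma fl_id: "v \<in> M \<Longrightarrow> fl v = v"
  using fl_eqI[of v id] stab_id M_weyl by simp

lemma fl_stab:
  assumes "v \<in> W" "u \<in> W\<^sub>J" shows "fl (v \<circ> u) = fl v"
proof -
  obtain u' where u': "u' \<in> W\<^sub>J" "fl v = v \<circ> u'" "v \<circ> u' \<in> M" using fl_obtain assms by blast
  have "v \<circ> u \<circ> (inv u \<circ> u') = v \<circ> u'" using assms stab_weyl by (auto simp: fun_eq_iff)
  moreover have "v \<circ> u \<in> W" "inv u \<circ> u' \<in> W\<^sub>J"
    using u' assms stab_weyl weyl_comp stab_comp stab_inv by blast+
  ultimately show ?thesis using fl_eqI[of "v \<circ> u" "inv u \<circ> u'"] u' by simp
qed

lemma lenJ_fl: "v \<in> W \<Longrightarrow> lenJ (fl v) = lenJ v"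
  by (metis fl_obtain lenJ_stab)

lemma len_fl: "v \<in> W \<Longrightarrow> len \<Delta> (fl v) = lenJ v"
  by (simp add: len_M fl_M lenJ_fl)

lemma min_reps_eq: "min_reps \<Phi> \<Delta> \<mu> = M"
proof
  show "min_reps \<Phi> \<Delta> \<mu> \<subseteq> M" unfolding min_reps_def using is_min_rep_M by blast
  show "M \<subseteq> min_reps \<Phi> \<Delta> \<mu>"
  proof
    fix w assume w: "w \<in> M"
    have "w \<in> (\<circ>) w ` W\<^sub>J" using stab_id by (metis comp_id image_eqI)
    then show "w \<in> min_reps \<Phi> \<Delta> \<mu>"
      unfolding min_reps_def using is_min_rep_iff w M_weyl by blast
  qed
qed

text \<open>If the product v = w r_\<gamma> were not minimal, it would send some simple root
  \<alpha> orthogonal to \<mu> to a negative root, so v r_\<alpha> is one shorter than v, while w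
  r_\<alpha> is one longer than w and hence as long as v. But w r_\<alpha> is still shorter than v
  r_\<alpha>, by the reflection in r_\<alpha> \<gamma>.\<close>

lemma cover_M:
  assumes "w \<in> M" "\<gamma> \<in> P" "len \<Delta> (w \<circ> reflection \<gamma>) = Suc (len \<Delta> w)"
  shows "w \<circ> reflection \<gamma> \<in> M"
proof (rule ccontr)
  let ?v = "w \<circ> reflection \<gamma>"
  assume notM: "?v \<notin> M"
  have W: "w \<in> W" "\<gamma> \<in> \<Phi>" "?v \<in> W" using assms M_weyl P_root weyl_comp weyl_reflection by auto
  have wg: "0 < ht (w \<gamma>)" using assms len_less_reflection_iff[OF W(1,2)] P_pos by auto
  \<comment> \<open>A positive root orthogonal to the dominant vector \<mu> is a combination of
    simple roots orthogonal to \<mu>: its pairing with \<mu> is a sum of nonnegative terms that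
    vanishes. So a violation at any such root forces one at a simple root.\<close>
  have "\<exists>\<alpha>\<in>\<Delta>. \<alpha> \<bullet> \<mu> = 0 \<and> ht (?v \<alpha>) < 0"
  proof (rule ccontr)
    assume no: "\<not> ?thesis"
    obtain \<beta> where b: "\<beta> \<in> \<Phi>" "\<beta> \<bullet> \<mu> = 0" "0 < ht \<beta>" "ht (?v \<beta>) < 0"
      using notM W root_ht_cases weyl_root unfolding M_def by blast
    have c: "0 \<le> coord \<delta> \<beta>" if "\<delta> \<in> \<Delta>" for \<delta>
      using nonneg_cone_coord[OF pos_root_cone[OF b(1,3)] that] .
    have "(\<Sum>\<delta>\<in>\<Delta>. coord \<delta> \<beta> * (\<delta> \<bullet> \<mu>)) = 0"
      using b(2) arg_cong[OF coord_expand[of \<beta>], of "\<lambda>x. x \<bullet> \<mu>"] by (simp add: inner_sum_left)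
    then have z: "coord \<delta> \<beta> * (\<delta> \<bullet> \<mu>) = 0" if "\<delta> \<in> \<Delta>" for \<delta>
      using that c base_inner by (subst (asm) sum_nonneg_eq_0_iff) (auto simp: finite_base)
    have "ht (?v \<beta>) = (\<Sum>\<delta>\<in>\<Delta>. coord \<delta> \<beta> * ht (?v \<delta>))"
      using arg_cong[OF coord_expand[of \<beta>], of "\<lambda>x. ht (?v x)"]
      by (simp add: linear_sum[OF linear_compose[OF weyl_linear[OF W(3)] linear_ht], unfolded comp_def]
          linear_cmul[OF linear_compose[OF weyl_linear[OF W(3)] linear_ht], unfolded comp_def])
    also have "\<dots> \<ge> 0"
    proof (rule sum_nonneg)
      fix \<delta> assume d: "\<delta> \<in> \<Delta>"
      show "0 \<le> coord \<delta> \<beta> * ht (?v \<delta>)"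
        using z[OF d] c[OF d] no d by (cases "coord \<delta> \<beta> = 0") auto
    qed
    finally show False using b by simp
  qed
  then obtain \<alpha> where \<alpha>: "\<alpha> \<in> \<Delta>" "\<alpha> \<bullet> \<mu> = 0" "ht (?v \<alpha>) < 0" by blast
  let ?s = "reflection \<alpha>"
  have a: "\<alpha> \<in> \<Phi>" using \<alpha> base_subset by blast
  have ne: "\<gamma> \<noteq> \<alpha>" using \<alpha> assms unfolding P_def by auto
  have sg: "?s \<gamma> \<in> \<Phi>" "0 < ht (?s \<gamma>)" "0 < ht ((w \<circ> ?s) (?s \<gamma>))"
    using simple_reflection_pos[OF \<alpha>(1)] ne W wg a reflection_root P_pos assms by auto
  have eq: "w \<circ> ?s \<circ> reflection (?s \<gamma>) = ?v \<circ> ?s"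
    using weyl_reflection_comp[OF weyl_reflection[OF a], of "?s \<gamma>"] by (simp add: comp_assoc)
  have "len \<Delta> (w \<circ> ?s) < len \<Delta> (?v \<circ> ?s)"
    using len_reflection_less[of "w \<circ> ?s" "?s \<gamma>"] sg W a weyl_comp weyl_reflection unfolding eq by blast
  moreover have "len \<Delta> (w \<circ> ?s) = Suc (len \<Delta> w)"
    using len_simple_right[OF W(1) \<alpha>(1)] M_pos[OF assms(1) a \<alpha>(2)] \<alpha> ht_base by fastforce
  moreover have "Suc (len \<Delta> (?v \<circ> ?s)) = len \<Delta> ?v"
    using len_simple_right[OF W(3) \<alpha>(1)] \<alpha> by linarith
  ultimately show False using assms(3) by simp
qed

text \<open>By \<open>cover_M\<close> the end of a cover along a label in \<open>P\<close> is
  already minimal, so the floor in the target disappears.\<close>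

lemma bruhat_edge_iff:
  "bruhat_edge \<Phi> \<Delta> \<mu> w \<gamma> v \<longleftrightarrow> w \<in> M \<and> \<gamma> \<in> P \<and> w \<circ> reflection \<gamma> \<in> M \<and>
     v = w \<circ> reflection \<gamma> \<and> lenJ (w \<circ> reflection \<gamma>) = Suc (lenJ w)"
proof -
  have "bruhat_edge \<Phi> \<Delta> \<mu> w \<gamma> v \<longleftrightarrow> w \<in> M \<and> \<gamma> \<in> P \<and> v = fl (w \<circ> reflection \<gamma>) \<and>
    len \<Delta> (w \<circ> reflection \<gamma>) = Suc (len \<Delta> w)"
    unfolding bruhat_edge_def min_reps_eq P_eq using bruhat_covers_iff M_weyl P_root by blast
  then show ?thesis using cover_M fl_id len_M by metis
qed

lemma quantum_edge_iff:
  "quantum_edge \<Phi> \<Delta> \<mu> w \<gamma> v \<longleftrightarrow> w \<in> M \<and> \<gamma> \<in> P \<and> v = fl (w \<circ> reflection \<gamma>) \<and>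
     real (lenJ (w \<circ> reflection \<gamma>)) = real (lenJ w) + 1 - coroot \<gamma> \<bullet> S"
  unfolding quantum_edge_def min_reps_eq P_eq two_rho_diff
  by (auto simp: len_M len_fl M_weyl P_root weyl_comp weyl_reflection)

subsection \<open>Quantum edges\<close>

definition D :: "'a \<Rightarrow> 'a set" where
  "D \<gamma> = {\<beta> \<in> P. reflection \<gamma> \<beta> \<notin> P}"

lemma reflection_inner_left: "reflection \<gamma> x \<bullet> y = x \<bullet> y - (coroot \<gamma> \<bullet> x) * (\<gamma> \<bullet> y)"
  by (simp add: reflection_def inner_diff_left)

text \<open>Leaving \<open>P\<close> means that the pairing with \<mu> drops from positive to
  nonpositive, so a positive multiple of \<gamma> has been subtracted; integrality raises this to at
  least 1.\<close>

lemma D_coroot: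
  assumes "\<gamma> \<in> P" "\<beta> \<in> D \<gamma>"
  shows "1 \<le> coroot \<gamma> \<bullet> \<beta>"
proof -
  have b: "\<beta> \<in> \<Phi>" "0 < \<beta> \<bullet> \<mu>" and g: "\<gamma> \<in> \<Phi>" "0 < \<gamma> \<bullet> \<mu>"
    using assms unfolding D_def P_def by auto
  have "reflection \<gamma> \<beta> \<bullet> \<mu> \<le> 0"
    using assms not_P reflection_root b g unfolding D_def by blast
  then have "0 < (coroot \<gamma> \<bullet> \<beta>) * (\<gamma> \<bullet> \<mu>)" using b by (simp add: reflection_inner_left)
  then have "0 < coroot \<gamma> \<bullet> \<beta>" using g by (simp add: zero_less_mult_iff)
  moreover obtain k where "coroot \<gamma> \<bullet> \<beta> = of_int k" using coroot_Ints[OF g(1) b(1)] Ints_cases by blast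
  ultimately show ?thesis by simp
qed

lemma self_in_D: "\<gamma> \<in> P \<Longrightarrow> \<gamma> \<in> D \<gamma>"
  unfolding D_def P_def by (simp add: reflection_self root_nonzero)

text \<open>The contribution of one root to the excess over the length bound. The pairings add up to
  the quantum correction, the term for \<beta> = \<gamma> accounts for the summand 1, and the last
  two terms record whether \<beta> is inverted before and after.\<close>

definition defect :: "('a \<Rightarrow> 'a) \<Rightarrow> 'a \<Rightarrow> 'a \<Rightarrow> real" where
  "defect w \<gamma> \<beta> = coroot \<gamma> \<bullet> \<beta> - of_bool (\<beta> = \<gamma>) - of_bool (ht (w \<beta>) < 0)
     + of_bool (ht (w (reflection \<gamma> \<beta>)) < 0)"

text \<open>At most 1 is lost by the sign terms, and the pairing is at least 1. For \<beta> =
  \<gamma> a further 1 is subtracted, but there the pairing is 2.\<close>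

lemma defect_nonneg:
  assumes "\<gamma> \<in> P" "\<beta> \<in> D \<gamma>"
  shows "0 \<le> defect w \<gamma> \<beta>"
  using D_coroot[OF assms] coroot_inner_self[of \<gamma>] root_nonzero[OF P_root[OF assms(1)]]
  unfolding defect_def by (cases "\<beta> = \<gamma>") auto

text \<open>On \<open>P \<inter> r\<^sub>\<gamma> P\<close> the reflection is an involution, so these roots contribute nothing to either
  side and only \<open>D \<gamma>\<close> matters.\<close>

lemma lenJ_defect:
  assumes "\<gamma> \<in> P"
  shows "real (lenJ (w \<circ> reflection \<gamma>)) = real (lenJ w) + 1 - coroot \<gamma> \<bullet> S + sum (defect w \<gamma>) (D \<gamma>)"
proof -
  let ?r = "reflection \<gamma>"
  define E where "E = {\<beta> \<in> P. ?r \<beta> \<in> P}"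
  have split: "sum f P = sum f (D \<gamma>) + sum f E" for f :: "'a \<Rightarrow> real"
  proof -
    have "P = D \<gamma> \<union> E" "D \<gamma> \<inter> E = {}" unfolding D_def E_def by auto
    then show ?thesis using finite_P by (metis finite_Un sum.union_disjoint)
  qed
  have inv: "(\<Sum>\<beta>\<in>E. f (?r \<beta>)) = sum f E" for f :: "'a \<Rightarrow> real"
    by (rule sum.reindex_bij_witness[of _ ?r ?r]) (auto simp: E_def)
  have "(\<Sum>\<beta>\<in>E. coroot \<gamma> \<bullet> \<beta>) = (\<Sum>\<beta>\<in>E. - (coroot \<gamma> \<bullet> \<beta>))"
    using inv[of "\<lambda>\<beta>. coroot \<gamma> \<bullet> \<beta>"]
    by (simp add: coroot_inner_reflection root_nonzero P_root assms)
  then have "(\<Sum>\<beta>\<in>E. coroot \<gamma> \<bullet> \<beta>) = 0" by (simp add: sum_negf)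
  then have 1: "coroot \<gamma> \<bullet> S = (\<Sum>\<beta>\<in>D \<gamma>. coroot \<gamma> \<bullet> \<beta>)"
    unfolding S_def by (simp add: inner_sum_right split)
  have l: "real (lenJ u) = (\<Sum>\<beta>\<in>P. of_bool (ht (u \<beta>) < 0))" for u
    unfolding lenJ_def by (simp add: sum_of_bool_eq finite_P Int_def)
  have 2: "real (lenJ w) = (\<Sum>\<beta>\<in>D \<gamma>. of_bool (ht (w \<beta>) < 0)) + (\<Sum>\<beta>\<in>E. of_bool (ht (w \<beta>) < 0))"
    unfolding l split ..
  have 3: "real (lenJ (w \<circ> ?r)) = (\<Sum>\<beta>\<in>D \<gamma>. of_bool (ht (w (?r \<beta>)) < 0))
      + (\<Sum>\<beta>\<in>E. of_bool (ht (w \<beta>) < 0))"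
    unfolding l split comp_apply inv[of "\<lambda>\<beta>. of_bool (ht (w \<beta>) < 0)"] ..
  have "finite (D \<gamma>)" unfolding D_def using finite_P by simp
  then have 4: "(\<Sum>\<beta>\<in>D \<gamma>. of_bool (\<beta> = \<gamma>)) = (1 :: real)"
    using self_in_D[OF assms] by (simp add: of_bool_def)
  show ?thesis
    unfolding 1 2 3 defect_def by (simp add: sum.distrib sum_subtractf 4)
qed

lemma lenJ_lower_bound:
  assumes "\<gamma> \<in> P"
  shows "real (lenJ w) + 1 - coroot \<gamma> \<bullet> S \<le> real (lenJ (w \<circ> reflection \<gamma>))"
  unfolding lenJ_defect[OF assms] using sum_nonneg[of "D \<gamma>" "defect w \<gamma>"] defect_nonneg[OF assms]
  by simp

text \<open>The length half of a quantum edge, stated with \<open>lenJ\<close> so that it makes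
  sense for elements that are not minimal, such as r_\<theta> w.\<close>

definition is_quantum :: "('a \<Rightarrow> 'a) \<Rightarrow> 'a \<Rightarrow> bool" where
  "is_quantum w \<gamma> \<longleftrightarrow> real (lenJ (w \<circ> reflection \<gamma>)) = real (lenJ w) + 1 - coroot \<gamma> \<bullet> S"

text \<open>A sum of nonnegative defects vanishes only termwise. Equality in a single term requires
  the inversion before, its absence after, and the smallest possible pairing.\<close>

lemma is_quantum_iff:
  assumes "w \<in> W" "\<gamma> \<in> P"
  shows "is_quantum w \<gamma> \<longleftrightarrow> (\<forall>\<beta>\<in>D \<gamma>. ht (w \<beta>) < 0 \<and> 0 < ht (w (reflection \<gamma> \<beta>)) \<and>
    (\<beta> \<noteq> \<gamma> \<longrightarrow> coroot \<gamma> \<bullet> \<beta> = 1))"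
proof -
  have g: "\<gamma> \<in> \<Phi>" using assms P_root by blast
  have "finite (D \<gamma>)" unfolding D_def using finite_P by simp
  then have "is_quantum w \<gamma> \<longleftrightarrow> (\<forall>\<beta>\<in>D \<gamma>. defect w \<gamma> \<beta> = 0)"
    unfolding is_quantum_def lenJ_defect[OF assms(2)]
    using defect_nonneg[OF assms(2)] by (simp add: sum_nonneg_eq_0_iff)
  also have "\<dots> \<longleftrightarrow> (\<forall>\<beta>\<in>D \<gamma>. ht (w \<beta>) < 0 \<and> 0 < ht (w (reflection \<gamma> \<beta>)) \<and>
    (\<beta> \<noteq> \<gamma> \<longrightarrow> coroot \<gamma> \<bullet> \<beta> = 1))"
  proof (rule ball_cong[OF refl])
    fix \<beta> assume b: "\<beta> \<in> D \<gamma>"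
    then have "\<beta> \<in> \<Phi>" unfolding D_def P_def by simp
    then have "ht (w (reflection \<gamma> \<beta>)) \<noteq> 0"
      using root_ht_nonzero weyl_root reflection_root g assms by blast
    then show "defect w \<gamma> \<beta> = 0 \<longleftrightarrow> ht (w \<beta>) < 0 \<and> 0 < ht (w (reflection \<gamma> \<beta>)) \<and>
      (\<beta> \<noteq> \<gamma> \<longrightarrow> coroot \<gamma> \<bullet> \<beta> = 1)"
      using D_coroot[OF assms(2) b] coroot_inner_self[OF root_nonzero[OF g]]
      unfolding defect_def by (cases "\<beta> = \<gamma>") (auto simp: of_bool_def)
  qed
  finally show ?thesis .
qed

lemma quantumD:
  assumes "is_quantum w \<gamma>" "w \<in> W" "\<gamma> \<in> P" "\<beta> \<in> \<Phi>" "0 < \<beta> \<bullet> \<mu>" "reflection \<gamma> \<beta> \<bullet> \<mu> \<le> 0"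
  shows "ht (w \<beta>) < 0" "0 < ht (w (reflection \<gamma> \<beta>))" "\<beta> \<noteq> \<gamma> \<Longrightarrow> coroot \<gamma> \<bullet> \<beta> = 1"
proof -
  have "\<beta> \<in> D \<gamma>" using assms(4-6) unfolding D_def P_def by simp
  then show "ht (w \<beta>) < 0" "0 < ht (w (reflection \<gamma> \<beta>))" "\<beta> \<noteq> \<gamma> \<Longrightarrow> coroot \<gamma> \<bullet> \<beta> = 1"
    using is_quantum_iff[OF assms(2,3)] assms(1) by blast+
qed

subsection \<open>Edges given by left multiplication by a simple reflection\<close>

lemma comp_reflection_inv: "w \<in> W \<Longrightarrow> w \<circ> reflection (inv w x) = reflection x \<circ> w"
  using weyl_reflection_comp[of w "inv w x"] by simp

lemma fl_left:
  assumes "x \<in> W" "y \<in> W" "x \<circ> fl y \<in> M"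
  shows "fl (x \<circ> y) = x \<circ> fl y"
proof -
  obtain u where u: "u \<in> W\<^sub>J" "fl y = y \<circ> u" using fl_obtain assms by blast
  then have "x \<circ> fl y = x \<circ> y \<circ> u" by (simp only: comp_assoc)
  then show ?thesis using fl_eqI[of "x \<circ> y" u] assms u weyl_comp by simp
qed

lemma lenJ_left_fl:
  assumes "x \<in> W" "y \<in> W"
  shows "lenJ (x \<circ> fl y) = lenJ (x \<circ> y)"
proof -
  obtain u where u: "u \<in> W\<^sub>J" "fl y = y \<circ> u" using fl_obtain assms by blast
  then have "x \<circ> fl y = x \<circ> y \<circ> u" by (simp only: comp_assoc)
  then show ?thesis using lenJ_stab[OF u(1)] by simp
qed

text \<open>The cases follow the sign of the pairing of \<open>inv v \<alpha>\<close> with \<mu>. If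
  it is zero, the product stays in the coset of \<open>v\<close>; it is not minimal, since its
  length differs by one. Otherwise no root orthogonal to \<mu> is mapped to \<alpha> by
  \<open>v\<close>, so the simple reflection preserves the signs required by \<open>M\<close> and
  the length changes by one.\<close>

lemma simple_left_cases:
  assumes "v \<in> M" "\<alpha> \<in> \<Delta>"
  obtains
    (up) "inv v \<alpha> \<in> P" "reflection \<alpha> \<circ> v \<in> M" "lenJ (reflection \<alpha> \<circ> v) = Suc (lenJ v)"
  | (stab) "inv v \<alpha> \<notin> P" "reflection \<alpha> \<circ> v \<notin> M" "lenJ (reflection \<alpha> \<circ> v) = lenJ v"
  | (down) "- inv v \<alpha> \<in> P" "inv v \<alpha> \<notin> P" "reflection \<alpha> \<circ> v \<in> M" "Suc (lenJ (reflection \<alpha> \<circ> v)) = lenJ v"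
proof -
  let ?\<kappa> = "inv v \<alpha>" and ?v = "reflection \<alpha> \<circ> v"
  have v: "v \<in> W" using assms M_weyl by blast
  have a: "\<alpha> \<in> \<Phi>" using assms base_subset by blast
  have k: "?\<kappa> \<in> \<Phi>" using a v weyl_inv weyl_root by blast
  have av: "?v \<in> W" using v a weyl_comp weyl_reflection by blast
  note len = len_simple_left[OF v assms(2)]
  show thesis
  proof (cases "?\<kappa> \<bullet> \<mu> = 0")
    case True
    have "?v = v \<circ> reflection ?\<kappa>" using comp_reflection_inv[OF v] by simp
    then have l: "lenJ ?v = lenJ v" using lenJ_stab reflection_stab_iff[OF k] True by simp
    moreover have "?v \<notin> M"
    proof
      assume "?v \<in> M"
      then have "len \<Delta> ?v = len \<Delta> v" using l len_M assms by simp
      then show False using len by auto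
    qed
    ultimately show thesis using stab True by (simp add: P_def)
  next
    case False
    have "0 < ht (?v \<beta>)" if b: "\<beta> \<in> \<Phi>" "\<beta> \<bullet> \<mu> = 0" "0 < ht \<beta>" for \<beta>
    proof -
      have "v \<beta> \<noteq> \<alpha>" using b False v by auto
      then show ?thesis
        using simple_reflection_pos[OF assms(2)] M_pos[OF assms(1) b] weyl_root[OF v b(1)] by simp
    qed
    then have M: "?v \<in> M" using av unfolding M_def by blast
    show thesis
    proof (cases "0 < ?\<kappa> \<bullet> \<mu>")
      case True
      then have "?\<kappa> \<in> P" using k unfolding P_def by simp
      then show thesis using up M len P_pos[of ?\<kappa>] len_M assms by fastforce
    next
      case neg: False
      then have "- ?\<kappa> \<in> P" "?\<kappa> \<notin> P" using False k uminus_root unfolding P_def by auto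
      then show thesis using down M len P_pos[of "- ?\<kappa>"] len_M assms by fastforce
    qed
  qed
qed

section \<open>The diamonds with a simple root\<close>

lemma bruhat_edge_simple_iff:
  assumes "\<alpha> \<in> \<Delta>"
  shows "bruhat_edge \<Phi> \<Delta> \<mu> v (inv v \<alpha>) (reflection \<alpha> \<circ> v) \<longleftrightarrow> v \<in> M \<and> inv v \<alpha> \<in> P"
proof (cases "v \<in> M")
  case True
  then have v: "v \<circ> reflection (inv v \<alpha>) = reflection \<alpha> \<circ> v" by (simp add: comp_reflection_inv M_weyl)
  show ?thesis
    unfolding bruhat_edge_iff v by (rule simple_left_cases[OF True assms]) (use True in auto)
qed (simp add: bruhat_edge_iff)

text \<open>The excluded label means w \<gamma> \<noteq> \<alpha>, so r_\<alpha> w \<gamma> stays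
  positive and r_\<alpha> v is longer than r_\<alpha> w, that is, longer than v. Left multiplication
  by r_\<alpha> therefore goes up by exactly one, and \<open>cover_M\<close> gives
  minimality.\<close>

lemma case_1a:
  assumes "\<alpha> \<in> \<Delta>" "\<gamma> \<noteq> inv w \<alpha>" "bruhat_edge \<Phi> \<Delta> \<mu> w (inv w \<alpha>) (reflection \<alpha> \<circ> w)"
    "bruhat_edge \<Phi> \<Delta> \<mu> w \<gamma> (fl (w \<circ> reflection \<gamma>))"
  defines "v \<equiv> fl (w \<circ> reflection \<gamma>)"
  shows "bruhat_edge \<Phi> \<Delta> \<mu> (reflection \<alpha> \<circ> w) \<gamma> (reflection \<alpha> \<circ> v) \<and>
    bruhat_edge \<Phi> \<Delta> \<mu> v (inv v \<alpha>) (reflection \<alpha> \<circ> v) \<and>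
    reflection \<alpha> \<circ> v = fl (reflection \<alpha> \<circ> w \<circ> reflection \<gamma>)"
proof -
  let ?a = "reflection \<alpha>"
  have w: "w \<in> M" "\<gamma> \<in> P" "inv w \<alpha> \<in> P" and vM: "v \<in> M" and v: "v = w \<circ> reflection \<gamma>"
    and lv: "lenJ v = Suc (lenJ w)"
    using assms bruhat_edge_iff bruhat_edge_simple_iff by auto
  have W: "w \<in> W" "\<gamma> \<in> \<Phi>" "\<alpha> \<in> \<Phi>" using w M_weyl P_root assms base_subset by auto
  have aw: "?a \<circ> w \<in> M" "lenJ (?a \<circ> w) = Suc (lenJ w)"
    by (rule simple_left_cases[OF w(1) assms(1)]; use w in blast)+
  have "len \<Delta> w < len \<Delta> (w \<circ> reflection \<gamma>)" using lv vM w len_M unfolding v by simp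
  then have "0 < ht (w \<gamma>)" using len_less_reflection_iff W P_pos w by blast
  moreover have "w \<gamma> \<noteq> \<alpha>" using assms(2) W by auto
  ultimately have "0 < ht ((?a \<circ> w) \<gamma>)"
    using simple_reflection_pos[OF assms(1)] weyl_root[OF W(1,2)] by simp
  then have "len \<Delta> (?a \<circ> w) < len \<Delta> (?a \<circ> w \<circ> reflection \<gamma>)"
    using len_less_reflection_iff[of "?a \<circ> w" \<gamma>] W P_pos w weyl_comp weyl_reflection by blast
  then have less: "Suc (lenJ w) < len \<Delta> (?a \<circ> v)"
    using aw len_M unfolding v comp_assoc by simp
  have eq: "?a \<circ> v = ?a \<circ> w \<circ> reflection \<gamma>" unfolding v by (simp only: comp_assoc)
  have pos: "0 < ht (inv v \<alpha>)" and lav: "len \<Delta> (?a \<circ> v) = Suc (len \<Delta> (?a \<circ> w))"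
    using less len_simple_left[of v \<alpha>] vM M_weyl assms(1) lv len_M aw by auto
  have avM: "?a \<circ> v \<in> M"
    using cover_M[OF aw(1) w(2)] lav unfolding eq by blast
  have k: "inv v \<alpha> \<in> P" and lJ: "lenJ (?a \<circ> v) = Suc (lenJ v)"
    by (rule simple_left_cases[OF vM assms(1)]; use avM pos P_pos[of "- inv v \<alpha>"] in simp)+
  show ?thesis
    unfolding bruhat_edge_iff[of "?a \<circ> w"] eq[symmetric] bruhat_edge_simple_iff[OF assms(1)]
    using w(2) aw avM k lJ vM lv fl_id by auto
qed

text \<open>The excluded label is the one carried by left multiplication with r_\<alpha> at the
  source r_\<alpha> w. If r_\<alpha> w were below w, then v, being as long as r_\<alpha> w, would be
  shorter than w; so w \<gamma> < 0 while r_\<alpha> w \<gamma> > 0, which leaves only w \<gamma> =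
  - \<alpha>.\<close>

lemma case_1a_converse:
  assumes "w \<in> M" "\<alpha> \<in> \<Delta>" "\<gamma> \<noteq> - inv w \<alpha>"
  defines "v \<equiv> fl (w \<circ> reflection \<gamma>)"
  assumes "bruhat_edge \<Phi> \<Delta> \<mu> (reflection \<alpha> \<circ> w) \<gamma> (reflection \<alpha> \<circ> v)"
    "bruhat_edge \<Phi> \<Delta> \<mu> v (inv v \<alpha>) (reflection \<alpha> \<circ> v)"
  shows "bruhat_edge \<Phi> \<Delta> \<mu> w (inv w \<alpha>) (reflection \<alpha> \<circ> w) \<and> bruhat_edge \<Phi> \<Delta> \<mu> w \<gamma> v \<and>
    reflection \<alpha> \<circ> v = fl (reflection \<alpha> \<circ> w \<circ> reflection \<gamma>)"
proof -
  let ?a = "reflection \<alpha>"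
  have aw: "?a \<circ> w \<in> M" "\<gamma> \<in> P" "?a \<circ> w \<circ> reflection \<gamma> \<in> M" "?a \<circ> v = ?a \<circ> w \<circ> reflection \<gamma>"
    "lenJ (?a \<circ> w \<circ> reflection \<gamma>) = Suc (lenJ (?a \<circ> w))"
    using assms(5) unfolding bruhat_edge_iff by blast+
  have k: "v \<in> M" "inv v \<alpha> \<in> P" using assms(6) bruhat_edge_simple_iff assms(2) by blast+
  have W: "w \<in> W" "\<gamma> \<in> \<Phi>" "\<alpha> \<in> \<Phi>" using assms aw M_weyl P_root base_subset by auto
  have v: "v = w \<circ> reflection \<gamma>"
  proof -
    have "?a \<circ> (?a \<circ> v) = ?a \<circ> (?a \<circ> (w \<circ> reflection \<gamma>))" using aw(4) by (simp only: comp_assoc)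
    then show ?thesis by (simp only: comp_reflection_cancel)
  qed
  have lv: "lenJ (?a \<circ> v) = Suc (lenJ v)"
    by (rule simple_left_cases[OF k(1) assms(2)]) (use k in auto)
  then have l: "lenJ v = lenJ (?a \<circ> w)" using aw by simp
  have "len \<Delta> (?a \<circ> w) < len \<Delta> (?a \<circ> w \<circ> reflection \<gamma>)" using aw len_M by simp
  then have awg: "0 < ht ((?a \<circ> w) \<gamma>)"
    using len_less_reflection_iff[of "?a \<circ> w" \<gamma>] W P_pos aw M_weyl by blast
  have up: "inv w \<alpha> \<in> P \<and> lenJ (?a \<circ> w) = Suc (lenJ w)"
  proof (rule simple_left_cases[OF assms(1,2)])
    assume "Suc (lenJ (?a \<circ> w)) = lenJ w"
    then have "\<not> len \<Delta> w < len \<Delta> (w \<circ> reflection \<gamma>)"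
      using l v k assms len_M by (metis Suc_n_not_le_n less_imp_le)
    then have wg: "ht (w \<gamma>) < 0"
      using len_less_reflection_iff[OF W(1,2)] P_pos aw root_ht_cases weyl_root W by blast
    have "- w \<gamma> = \<alpha>"
    proof (rule ccontr)
      assume "- w \<gamma> \<noteq> \<alpha>"
      then have "0 < ht (?a (- w \<gamma>))"
        using simple_reflection_pos[OF assms(2), of "- w \<gamma>"] wg weyl_root W uminus_root by simp
      then show False using awg by (simp add: linear_neg[OF linear_reflection])
    qed
    then have "\<gamma> = - inv w \<alpha>" using W by (metis weyl_inv_apply(1) weyl_uminus add.inverse_inverse)
    then show ?thesis using assms by blast
  qed (use aw in auto)
  show ?thesis
    using up assms(1,2) k l aw fl_id v by (simp add: bruhat_edge_simple_iff bruhat_edge_iff[of w \<gamma>])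
qed

text \<open>No label needs to be excluded because the lower bound on lengths does the work: applied
  at r_\<alpha> w, it makes r_\<alpha> v longer than v. Going up by one is the only possibility
  left, and then the bound is attained.\<close>

lemma case_1b:
  assumes "\<alpha> \<in> \<Delta>" "bruhat_edge \<Phi> \<Delta> \<mu> w (inv w \<alpha>) (reflection \<alpha> \<circ> w)"
    "quantum_edge \<Phi> \<Delta> \<mu> w \<gamma> (fl (w \<circ> reflection \<gamma>))"
  defines "v \<equiv> fl (w \<circ> reflection \<gamma>)"
  shows "quantum_edge \<Phi> \<Delta> \<mu> (reflection \<alpha> \<circ> w) \<gamma> (reflection \<alpha> \<circ> v) \<and>
    bruhat_edge \<Phi> \<Delta> \<mu> v (inv v \<alpha>) (reflection \<alpha> \<circ> v) \<and>
    reflection \<alpha> \<circ> v = fl (reflection \<alpha> \<circ> w \<circ> reflection \<gamma>)"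
proof -
  let ?a = "reflection \<alpha>" and ?g = "reflection \<gamma>"
  have w: "w \<in> M" "\<gamma> \<in> P" "inv w \<alpha> \<in> P" and q: "real (lenJ (w \<circ> ?g)) = real (lenJ w) + 1 - coroot \<gamma> \<bullet> S"
    using assms quantum_edge_iff bruhat_edge_simple_iff by auto
  have W: "w \<circ> ?g \<in> W" "?a \<in> W" using w M_weyl P_root assms base_subset weyl_comp weyl_reflection by auto
  have aw: "?a \<circ> w \<in> M" "lenJ (?a \<circ> w) = Suc (lenJ w)"
    by (rule simple_left_cases[OF w(1) assms(1)]; use w in blast)+
  have vM: "v \<in> M" and lv: "lenJ v = lenJ (w \<circ> ?g)" unfolding v_def using W fl_M lenJ_fl by auto
  have lav: "lenJ (?a \<circ> v) = lenJ (?a \<circ> w \<circ> ?g)"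
    unfolding v_def lenJ_left_fl[OF W(2,1)] by (simp only: comp_assoc)
  have "real (lenJ v) < real (lenJ (?a \<circ> v))"
    using lenJ_lower_bound[OF w(2), of "?a \<circ> w"] aw q lv lav by simp
  then have up: "inv v \<alpha> \<in> P" "?a \<circ> v \<in> M" "lenJ (?a \<circ> v) = Suc (lenJ v)"
    by (auto intro: simple_left_cases[OF vM assms(1)])
  have f: "?a \<circ> v = fl (?a \<circ> w \<circ> ?g)"
    using fl_left[OF W(2,1)] up(2) unfolding v_def by (simp only: comp_assoc)
  have "bruhat_edge \<Phi> \<Delta> \<mu> v (inv v \<alpha>) (?a \<circ> v)"
    using bruhat_edge_simple_iff[OF assms(1)] vM up(1) by blast
  moreover have "quantum_edge \<Phi> \<Delta> \<mu> (?a \<circ> w) \<gamma> (?a \<circ> v)"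
    unfolding quantum_edge_iff using f aw w(2) up(3) lv lav q by simp
  ultimately show ?thesis using f by blast
qed

text \<open>If r_\<alpha> w were below w, the lower bound at w would make v longer than r_\<alpha>
  v, against the upper Bruhat edge; and r_\<alpha> w is minimal, so it is not in the coset of
  w.\<close>

lemma case_1b_converse:
  fixes \<gamma> :: 'a
  assumes "w \<in> M" "\<alpha> \<in> \<Delta>"
  defines "v \<equiv> fl (w \<circ> reflection \<gamma>)"
  assumes "quantum_edge \<Phi> \<Delta> \<mu> (reflection \<alpha> \<circ> w) \<gamma> (reflection \<alpha> \<circ> v)"
    "bruhat_edge \<Phi> \<Delta> \<mu> v (inv v \<alpha>) (reflection \<alpha> \<circ> v)"
  shows "bruhat_edge \<Phi> \<Delta> \<mu> w (inv w \<alpha>) (reflection \<alpha> \<circ> w) \<and> quantum_edge \<Phi> \<Delta> \<mu> w \<gamma> v \<and>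
    reflection \<alpha> \<circ> v = fl (reflection \<alpha> \<circ> w \<circ> reflection \<gamma>)"
proof -
  let ?a = "reflection \<alpha>" and ?g = "reflection \<gamma>"
  have aw: "?a \<circ> w \<in> M" "\<gamma> \<in> P" "?a \<circ> v = fl (?a \<circ> w \<circ> ?g)"
    and q: "real (lenJ (?a \<circ> w \<circ> ?g)) = real (lenJ (?a \<circ> w)) + 1 - coroot \<gamma> \<bullet> S"
    using assms(4) unfolding quantum_edge_iff by blast+
  have W: "w \<circ> ?g \<in> W" "?a \<in> W"
    using assms aw M_weyl P_root base_subset weyl_comp weyl_reflection by auto
  have k: "v \<in> M" "inv v \<alpha> \<in> P" using assms(5) bruhat_edge_simple_iff assms(2) by blast+
  have lv: "lenJ v = lenJ (w \<circ> ?g)" unfolding v_def using W lenJ_fl by auto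
  have lav: "lenJ (?a \<circ> v) = lenJ (?a \<circ> w \<circ> ?g)"
    unfolding v_def lenJ_left_fl[OF W(2,1)] by (simp only: comp_assoc)
  have s: "lenJ (?a \<circ> v) = Suc (lenJ v)"
    by (rule simple_left_cases[OF k(1) assms(2)]) (use k in auto)
  have up: "inv w \<alpha> \<in> P \<and> lenJ (?a \<circ> w) = Suc (lenJ w)"
    by (rule simple_left_cases[OF assms(1,2)])
      (use aw q lv lav s lenJ_lower_bound[OF aw(2), of w] in auto)
  show ?thesis
    using up aw assms(1) lv lav q s v_def
    by (simp add: bruhat_edge_simple_iff assms(2) quantum_edge_iff del: comp_apply)
qed

end

subsection \<open>The highest root\<close>

locale highest_root_system = parabolic_root_system +
  fixes \<theta> :: "'a"
  assumes highest: "highest_root \<Phi> \<Delta> \<theta>"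
begin

lemma theta_root: "\<theta> \<in> \<Phi>"
  and theta_diff: "\<beta> \<in> \<Phi> \<Longrightarrow> \<theta> - \<beta> \<in> nonneg_cone \<Delta>"
  using highest unfolding highest_root_def by auto

lemma ht_le_theta: "\<beta> \<in> \<Phi> \<Longrightarrow> ht \<beta> \<le> ht \<theta>"
  using nonneg_cone_ht[OF theta_diff] by fastforce

lemma theta_pos: "0 < ht \<theta>"
  using ht_le_theta[OF uminus_root[OF theta_root]] root_ht_nonzero[OF theta_root] by simp

text \<open>With a negative pairing, reflecting \<theta> in \<beta> would add a positive multiple of
  \<beta> and produce a root higher than \<theta>.\<close>

lemma theta_inner_nonneg:
  assumes "\<beta> \<in> \<Phi>" "0 < ht \<beta>" shows "0 \<le> coroot \<theta> \<bullet> \<beta>"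
proof -
  have "ht (reflection \<beta> \<theta>) \<le> ht \<theta>"
    using ht_le_theta reflection_root assms theta_root by blast
  then have "0 \<le> coroot \<beta> \<bullet> \<theta>" using assms by (simp add: reflection_def zero_le_mult_iff)
  then show ?thesis
    using coroot_inner_neg_iff root_nonzero assms theta_root by (metis inner_commute not_less)
qed

lemma theta_sign:
  assumes "\<beta> \<in> \<Phi>"
  shows "0 < coroot \<theta> \<bullet> \<beta> \<Longrightarrow> 0 < ht \<beta>" "coroot \<theta> \<bullet> \<beta> < 0 \<Longrightarrow> ht \<beta> < 0"
  using theta_inner_nonneg[OF assms] theta_inner_nonneg[OF uminus_root[OF assms]]
    root_ht_cases[OF assms] by auto

text \<open>A nonzero pairing with the coroot of \<theta> has the sign of the root, and r_\<theta>
  negates that pairing; roots with pairing zero are fixed.\<close>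

lemma theta_reflection_pos_iff:
  assumes "\<beta> \<in> \<Phi>"
  shows "0 < ht (reflection \<theta> \<beta>) \<longleftrightarrow> coroot \<theta> \<bullet> \<beta> < 0 \<or> coroot \<theta> \<bullet> \<beta> = 0 \<and> 0 < ht \<beta>"
proof -
  have r: "reflection \<theta> \<beta> \<in> \<Phi>" using reflection_root theta_root assms by blast
  have c: "coroot \<theta> \<bullet> reflection \<theta> \<beta> = - (coroot \<theta> \<bullet> \<beta>)"
    by (simp add: coroot_inner_reflection root_nonzero theta_root)
  consider "coroot \<theta> \<bullet> \<beta> < 0" | "coroot \<theta> \<bullet> \<beta> = 0" | "0 < coroot \<theta> \<bullet> \<beta>" by linarith
  then show ?thesis
  proof cases
    case 2
    then have "reflection \<theta> \<beta> = \<beta>" by (simp add: reflection_def)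
    then show ?thesis using 2 by simp
  qed (use theta_sign[OF r] c in auto)
qed

text \<open>With pairing at least 2, the root - r_\<theta> \<beta> would have height at least twice
  that of \<theta> minus that of \<beta>. As \<theta> is highest, this forces equal heights and
  \<beta> = \<theta>.\<close>

lemma theta_coroot_le:
  assumes "\<beta> \<in> \<Phi>" "\<beta> \<noteq> \<theta>" shows "coroot \<theta> \<bullet> \<beta> \<le> 1"
proof (rule ccontr)
  assume gt: "\<not> ?thesis"
  obtain k where k: "coroot \<theta> \<bullet> \<beta> = of_int k" using coroot_Ints[OF theta_root assms(1)] Ints_cases by blast
  have "2 \<le> coroot \<theta> \<bullet> \<beta>" using gt unfolding k by simp
  then have "2 * ht \<theta> \<le> (coroot \<theta> \<bullet> \<beta>) * ht \<theta>" using theta_pos by simp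
  moreover have "ht (- reflection \<theta> \<beta>) \<le> ht \<theta>"
    using ht_le_theta reflection_root uminus_root theta_root assms by blast
  ultimately have "ht \<theta> \<le> ht \<beta>" by (simp add: reflection_def)
  then have "\<theta> - \<beta> = 0"
    using ht_le_theta[OF assms(1)] nonneg_cone_ht_0[OF theta_diff[OF assms(1)]] by simp
  then show False using assms by simp
qed

lemma theta_coroot_pos:
  assumes "\<beta> \<in> \<Phi>" "\<beta> \<noteq> \<theta>" "0 < coroot \<theta> \<bullet> \<beta>" shows "coroot \<theta> \<bullet> \<beta> = 1"
proof -
  obtain k where "coroot \<theta> \<bullet> \<beta> = of_int k" using coroot_Ints[OF theta_root assms(1)] Ints_cases by blast
  then show ?thesis using theta_coroot_le[OF assms(1,2)] assms(3) by simp
qed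

lemma theta_coroot_neg:
  assumes "\<beta> \<in> \<Phi>" "\<beta> \<noteq> - \<theta>" "coroot \<theta> \<bullet> \<beta> < 0" shows "coroot \<theta> \<bullet> \<beta> = - 1"
  using theta_coroot_pos[of "- \<beta>"] uminus_root[of \<beta>] assms by (force simp: minus_equation_iff)

lemma coroot_inv_theta: "w \<in> W \<Longrightarrow> coroot (inv w \<theta>) \<bullet> x = coroot \<theta> \<bullet> w x"
  using weyl_coroot_inner[of w "inv w \<theta>" x] by simp

lemma inv_theta_root: "w \<in> W \<Longrightarrow> inv w \<theta> \<in> \<Phi>"
  by (simp add: weyl_root weyl_inv theta_root)

lemma uminus_inv_theta_P: "w \<in> W \<Longrightarrow> - inv w \<theta> \<in> P \<longleftrightarrow> inv w \<theta> \<bullet> \<mu> < 0"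
  unfolding P_def by (simp add: inv_theta_root uminus_root)

text \<open>Transported by \<open>w\<close>, the equality criterion concerns roots pairing
  negatively with \<theta>. These are negative, become positive under r_\<theta>, and have pairing
  -1 apart from - \<theta>, which corresponds to the label itself.\<close>

lemma theta_is_quantum:
  assumes "w \<in> W" "inv w \<theta> \<bullet> \<mu> < 0"
  shows "is_quantum w (- inv w \<theta>)"
proof -
  let ?\<eta> = "inv w \<theta>"
  have P: "- ?\<eta> \<in> P" using assms uminus_inv_theta_P by blast
  show ?thesis
    unfolding is_quantum_iff[OF assms(1) P]
  proof (intro ballI conjI impI)
    fix \<beta> assume b: "\<beta> \<in> D (- ?\<eta>)"
    then have bR: "\<beta> \<in> \<Phi>" unfolding D_def P_def by simp
    then have wb: "w \<beta> \<in> \<Phi>" using weyl_root assms by blast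
    have c: "coroot (- ?\<eta>) \<bullet> \<beta> = - (coroot \<theta> \<bullet> w \<beta>)"
      using coroot_inv_theta[OF assms(1)] by (simp add: coroot_uminus)
    then have neg: "coroot \<theta> \<bullet> w \<beta> < 0" using D_coroot[OF P b] by simp
    show "ht (w \<beta>) < 0" using theta_sign[OF wb] neg by blast
    have "w (reflection (- ?\<eta>) \<beta>) = reflection \<theta> (w \<beta>)"
      using weyl_reflection_apply[OF assms(1), of ?\<eta> \<beta>] assms by (simp add: reflection_uminus)
    then show "0 < ht (w (reflection (- ?\<eta>) \<beta>))" using theta_reflection_pos_iff[OF wb] neg by simp
    assume "\<beta> \<noteq> - ?\<eta>"
    then have "w \<beta> \<noteq> - \<theta>" using assms(1) by (metis weyl_inv weyl_inv_apply(1) weyl_uminus)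
    then show "coroot (- ?\<eta>) \<bullet> \<beta> = 1" using theta_coroot_neg[OF wb _ neg] c by simp
  qed
qed

lemma comp_reflection_uminus_inv: "w \<in> W \<Longrightarrow> w \<circ> reflection (- inv w x) = reflection x \<circ> w"
  by (simp only: reflection_uminus comp_reflection_inv)

lemma lenJ_theta:
  assumes "w \<in> W" "inv w \<theta> \<bullet> \<mu> < 0"
  shows "real (lenJ (reflection \<theta> \<circ> w)) = real (lenJ w) + 1 + coroot (inv w \<theta>) \<bullet> S"
  using theta_is_quantum[OF assms] unfolding is_quantum_def comp_reflection_uminus_inv[OF assms(1)]
  by (simp add: coroot_uminus)

text \<open>Changing \<open>y\<close> within its coset applies an element of W_J to
  \<open>inv y \<theta>\<close>, which does not affect the pairing with \<mu>. The criterion can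
  thus be read off any representative.\<close>

lemma quantum_edge_theta_iff:
  assumes "y \<in> W"
  shows "quantum_edge \<Phi> \<Delta> \<mu> (fl y) (- inv (fl y) \<theta>) (fl (reflection \<theta> \<circ> y)) \<longleftrightarrow> inv y \<theta> \<bullet> \<mu> < 0"
proof -
  obtain u where u: "u \<in> W\<^sub>J" "fl y = y \<circ> u" using fl_obtain assms by blast
  have f: "fl y \<in> W" using assms fl_M M_weyl by blast
  have "inv y \<theta> = u (inv (fl y) \<theta>)"
    using weyl_inv_apply(2)[OF f, of \<theta>] u(2) assms
    by (metis comp_apply weyl_inv_apply(1))
  then have i: "inv y \<theta> \<bullet> \<mu> = inv (fl y) \<theta> \<bullet> \<mu>" using stab_inner[OF u(1)] by simp
  have "fl (reflection \<theta> \<circ> fl y) = fl (reflection \<theta> \<circ> y \<circ> u)" unfolding u(2) by (simp only: comp_assoc)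
  then have "fl (reflection \<theta> \<circ> fl y) = fl (reflection \<theta> \<circ> y)"
    using fl_stab[OF _ u(1)] assms weyl_comp weyl_reflection theta_root by simp
  then show ?thesis
    using fl_M[OF assms] theta_is_quantum[OF f] uminus_inv_theta_P[OF f]
    unfolding quantum_edge_iff comp_reflection_uminus_inv[OF f] i is_quantum_def by auto
qed

lemma inv_theta_reflection:
  assumes "w \<in> W" "\<gamma> \<in> \<Phi>"
  shows "inv (w \<circ> reflection \<gamma>) \<theta> = reflection \<gamma> (inv w \<theta>)"
  using weyl_inv_apply(1)[OF weyl_comp[OF assms(1) weyl_reflection[OF assms(2)]], of "reflection \<gamma> (inv w \<theta>)"]
  by (simp add: assms(1))

text \<open>This is \<open>lenJ_theta\<close> at w r_\<gamma>, with the reflection moved from the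
  coroot onto \<open>S\<close>. The extra product at the end is the source of the exchange between
  Bruhat and quantum edges.\<close>

lemma lenJ_theta_reflection:
  assumes "w \<in> W" "\<gamma> \<in> \<Phi>" "reflection \<gamma> (inv w \<theta>) \<bullet> \<mu> < 0"
  shows "real (lenJ (reflection \<theta> \<circ> w \<circ> reflection \<gamma>)) = real (lenJ (w \<circ> reflection \<gamma>)) + 1
    + coroot (inv w \<theta>) \<bullet> S - (coroot \<gamma> \<bullet> S) * (coroot \<theta> \<bullet> w \<gamma>)"
proof -
  let ?\<eta> = "inv w \<theta>"
  have "coroot (reflection \<gamma> ?\<eta>) \<bullet> S = reflection \<gamma> (coroot ?\<eta>) \<bullet> reflection \<gamma> (reflection \<gamma> S)"
    by (simp add: coroot_orthogonal orthogonal_reflection)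
  also have "\<dots> = coroot ?\<eta> \<bullet> S - (coroot \<gamma> \<bullet> S) * (coroot ?\<eta> \<bullet> \<gamma>)"
    by (simp only: inner_reflection) (simp add: reflection_def inner_diff_right)
  finally show ?thesis
    using lenJ_theta[of "w \<circ> reflection \<gamma>"] assms inv_theta_reflection[OF assms(1,2)]
      coroot_inv_theta[OF assms(1)]
    by (simp add: weyl_comp weyl_reflection comp_assoc del: comp_apply)
qed

text \<open>The coset version of minimality. Elements that need not lie in \<open>M\<close> are
  compared, and the relation is unchanged when both are multiplied on the right by the same element
  of W_J.\<close>

definition same_sign :: "('a \<Rightarrow> 'a) \<Rightarrow> ('a \<Rightarrow> 'a) \<Rightarrow> bool" where
  "same_sign v w \<longleftrightarrow> (\<forall>\<beta>\<in>\<Phi>. \<beta> \<bullet> \<mu> = 0 \<longrightarrow> (0 < ht (v \<beta>) \<longleftrightarrow> 0 < ht (w \<beta>)))"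

text \<open>One implication suffices because the roots orthogonal to \<mu> are closed under
  negation.\<close>

lemma same_signI:
  assumes "v \<in> W" "w \<in> W"
    and "\<And>\<beta>. \<beta> \<in> \<Phi> \<Longrightarrow> \<beta> \<bullet> \<mu> = 0 \<Longrightarrow> 0 < ht (w \<beta>) \<Longrightarrow> 0 < ht (v \<beta>)"
  shows "same_sign v w"
  unfolding same_sign_def
proof (intro ballI impI iffI)
  fix \<beta> assume b: "\<beta> \<in> \<Phi>" "\<beta> \<bullet> \<mu> = 0" "0 < ht (v \<beta>)"
  show "0 < ht (w \<beta>)"
  proof (rule ccontr)
    assume "\<not> ?thesis"
    then have "0 < ht (w (- \<beta>))"
      using root_ht_cases[OF weyl_root[OF assms(2) b(1)]] by (simp add: weyl_uminus assms)
    then have "0 < ht (v (- \<beta>))" using assms(3)[of "- \<beta>"] b uminus_root by simp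
    then show False using b by (simp add: weyl_uminus assms)
  qed
qed (rule assms(3))

lemma M_same_sign: "w \<in> M \<Longrightarrow> v \<in> W \<Longrightarrow> v \<in> M \<longleftrightarrow> same_sign v w"
  using M_pos_iff unfolding same_sign_def M_def[of] by auto

lemma M_same_sign_stab:
  assumes "w \<circ> u \<in> M" "v \<in> W" "u \<in> W\<^sub>J"
  shows "v \<circ> u \<in> M \<longleftrightarrow> same_sign v w"
proof -
  have "v \<circ> u \<in> M \<longleftrightarrow> same_sign (v \<circ> u) (w \<circ> u)"
    using M_same_sign assms weyl_comp stab_weyl by blast
  also have "\<dots> \<longleftrightarrow> same_sign v w"
  proof
    assume s: "same_sign (v \<circ> u) (w \<circ> u)"
    show "same_sign v w"
      unfolding same_sign_def
    proof (intro ballI impI)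
      fix \<beta> assume b: "\<beta> \<in> \<Phi>" "\<beta> \<bullet> \<mu> = 0"
      have "inv u \<beta> \<in> \<Phi>" "inv u \<beta> \<bullet> \<mu> = 0"
        using b assms stab_inv stab_inner stab_weyl weyl_root by auto
      then show "0 < ht (v \<beta>) \<longleftrightarrow> 0 < ht (w \<beta>)"
        using s assms stab_weyl unfolding same_sign_def by force
    qed
  next
    assume s: "same_sign v w"
    then show "same_sign (v \<circ> u) (w \<circ> u)"
      unfolding same_sign_def using stab_inner[OF assms(3)] weyl_root[OF stab_weyl[OF assms(3)]] by simp
  qed
  finally show ?thesis .
qed

text \<open>The sign after r_\<theta> depends only on the sign before and on the pairing with
  \<theta>; equal preimages of \<theta> give equal pairings.\<close>

lemma same_sign_theta:
  assumes "v \<in> W" "w \<in> W" "inv v \<theta> = inv w \<theta>" "same_sign v w"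
  shows "same_sign (reflection \<theta> \<circ> v) (reflection \<theta> \<circ> w)"
  unfolding same_sign_def
proof (intro ballI impI)
  fix \<beta> assume b: "\<beta> \<in> \<Phi>" "\<beta> \<bullet> \<mu> = 0"
  have "coroot \<theta> \<bullet> v \<beta> = coroot \<theta> \<bullet> w \<beta>"
    using assms coroot_inv_theta by metis
  then show "0 < ht ((reflection \<theta> \<circ> v) \<beta>) \<longleftrightarrow> 0 < ht ((reflection \<theta> \<circ> w) \<beta>)"
    using assms(4) b unfolding same_sign_def
    by (simp add: theta_reflection_pos_iff weyl_root assms)
qed

subsection \<open>The diamonds\<close>

text \<open>Up to right multiplication by \<open>inv z\<close>, reflecting the floor of
  \<open>y\<close> along z \<gamma> is the same as reflecting \<open>y\<close> along \<gamma>. This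
  is why z \<gamma> is the label of the upper edge.\<close>

lemma fl_stab_reflection:
  assumes "y \<in> W" "z \<in> W\<^sub>J" "y = fl y \<circ> z"
  shows "fl y = y \<circ> inv z" "fl y \<circ> reflection (z \<gamma>) = y \<circ> reflection \<gamma> \<circ> inv z"
proof -
  have z: "z \<circ> inv z = id" using assms stab_weyl by (auto simp: fun_eq_iff)
  have "fl y \<circ> z \<circ> inv z = y \<circ> inv z" using assms(3) by simp
  then show e: "fl y = y \<circ> inv z" by (simp only: comp_assoc z comp_id)
  have "reflection (z \<gamma>) \<circ> z \<circ> inv z = z \<circ> reflection \<gamma> \<circ> inv z"
    by (simp only: weyl_reflection_comp[OF stab_weyl[OF assms(2)]])
  then have "reflection (z \<gamma>) = z \<circ> (reflection \<gamma> \<circ> inv z)" by (simp only: comp_assoc z comp_id)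
  then have "fl y \<circ> reflection (z \<gamma>) = fl y \<circ> z \<circ> (reflection \<gamma> \<circ> inv z)" by (simp only: comp_assoc)
  then show "fl y \<circ> reflection (z \<gamma>) = y \<circ> reflection \<gamma> \<circ> inv z"
    using assms(3) by (simp only: comp_assoc)
qed

lemma quantum_edge_stab_iff:
  assumes "y \<in> W" "z \<in> W\<^sub>J" "y = fl y \<circ> z" "\<gamma> \<in> P"
  shows "quantum_edge \<Phi> \<Delta> \<mu> (fl y) (z \<gamma>) (fl (y \<circ> reflection \<gamma>)) \<longleftrightarrow> is_quantum y \<gamma>"
proof -
  have iz: "inv z \<in> W\<^sub>J" and yg: "y \<circ> reflection \<gamma> \<in> W"
    using assms stab_inv weyl_comp weyl_reflection P_root by blast+
  have c: "coroot (z \<gamma>) \<bullet> S = coroot \<gamma> \<bullet> S"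
    using weyl_coroot_inner[OF stab_weyl[OF assms(2)], of \<gamma> S] stab_S[OF assms(2)] by simp
  show ?thesis
    unfolding quantum_edge_iff is_quantum_def fl_stab_reflection(2)[OF assms(1-3)] c
      fl_stab[OF yg iz] lenJ_stab[OF iz] lenJ_fl[OF assms(1)]
    using fl_M[OF assms(1)] assms stab_P_iff by blast
qed

lemma bruhat_edge_stab_iff:
  assumes "y \<in> W" "z \<in> W\<^sub>J" "y = fl y \<circ> z" "\<gamma> \<in> P"
  shows "bruhat_edge \<Phi> \<Delta> \<mu> (fl y) (z \<gamma>) (fl (y \<circ> reflection \<gamma>)) \<longleftrightarrow>
    same_sign (y \<circ> reflection \<gamma>) y \<and> lenJ (y \<circ> reflection \<gamma>) = Suc (lenJ y)"
proof -
  have iz: "inv z \<in> W\<^sub>J" and yg: "y \<circ> reflection \<gamma> \<in> W"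
    using assms stab_inv weyl_comp weyl_reflection P_root by blast+
  have s: "y \<circ> reflection \<gamma> \<circ> inv z \<in> M \<longleftrightarrow> same_sign (y \<circ> reflection \<gamma>) y"
    using M_same_sign_stab[OF _ yg iz, of y] fl_M[OF assms(1)] fl_stab_reflection(1)[OF assms(1-3)] by simp
  show ?thesis
    unfolding bruhat_edge_iff fl_stab_reflection(2)[OF assms(1-3)] s
      lenJ_stab[OF iz] lenJ_fl[OF assms(1)]
    using fl_M[OF assms(1)] assms stab_P_iff fl_eqI[OF yg _ iz] s by blast
qed

text \<open>Exchanging which of two roots is replaced by its coroot can rescale the pairing by a
  ratio of squared lengths, so only its sign or vanishing is transferred.\<close>

lemma inner_coroot_inv_theta_iff:
  assumes "w \<in> W" "\<gamma> \<in> \<Phi>"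
  shows "inv w \<theta> \<bullet> coroot \<gamma> = 0 \<longleftrightarrow> coroot \<theta> \<bullet> w \<gamma> = 0"
    and "0 < coroot \<gamma> \<bullet> inv w \<theta> \<longleftrightarrow> 0 < coroot \<theta> \<bullet> w \<gamma>"
    and "coroot \<gamma> \<bullet> inv w \<theta> < 0 \<longleftrightarrow> coroot \<theta> \<bullet> w \<gamma> < 0"
proof -
  have n: "\<gamma> \<noteq> 0" "inv w \<theta> \<noteq> 0" using assms root_nonzero inv_theta_root by auto
  show "inv w \<theta> \<bullet> coroot \<gamma> = 0 \<longleftrightarrow> coroot \<theta> \<bullet> w \<gamma> = 0"
    and "0 < coroot \<gamma> \<bullet> inv w \<theta> \<longleftrightarrow> 0 < coroot \<theta> \<bullet> w \<gamma>"
    and "coroot \<gamma> \<bullet> inv w \<theta> < 0 \<longleftrightarrow> coroot \<theta> \<bullet> w \<gamma> < 0"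
    unfolding coroot_inv_theta[OF assms(1), symmetric]
    using coroot_inner_eq_0_iff[OF n(1), of "inv w \<theta>"] coroot_inner_eq_0_iff[OF n(2), of \<gamma>]
      coroot_inner_pos_iff[OF n(1), of "inv w \<theta>"] coroot_inner_pos_iff[OF n(2), of \<gamma>]
      coroot_inner_neg_iff[OF n(1), of "inv w \<theta>"] coroot_inner_neg_iff[OF n(2), of \<gamma>]
    by (simp_all add: inner_commute)
qed

lemma reflection_inv_theta_orthogonal:
  assumes "w \<in> W" "\<gamma> \<in> \<Phi>" "coroot \<theta> \<bullet> w \<gamma> = 0"
  shows "reflection \<gamma> (inv w \<theta>) = inv w \<theta>"
  using inner_coroot_inv_theta_iff(1)[OF assms(1,2)] assms(3)
  by (simp add: reflection_def inner_commute)

text \<open>Orthogonality means that r_\<gamma> fixes \<open>inv w \<theta>\<close>, so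
  \<open>same_sign_theta\<close> gives one direction. The other is the same argument for r_\<theta>
  w, since r_\<theta> is an involution.\<close>

lemma same_sign_orthogonal_iff:
  assumes "w \<in> W" "\<gamma> \<in> \<Phi>" "coroot \<theta> \<bullet> w \<gamma> = 0"
  shows "same_sign (reflection \<theta> \<circ> w \<circ> reflection \<gamma>) (reflection \<theta> \<circ> w) \<longleftrightarrow>
    same_sign (w \<circ> reflection \<gamma>) w"
proof -
  let ?t = "reflection \<theta>" and ?g = "reflection \<gamma>"
  have W: "w \<circ> ?g \<in> W" "?t \<in> W" "?t \<circ> w \<in> W" "?t \<circ> w \<circ> ?g \<in> W"
    using assms theta_root weyl_comp weyl_reflection by auto
  have "inv (w \<circ> ?g) \<theta> = inv w \<theta>"
    using inv_theta_reflection reflection_inv_theta_orthogonal assms by simp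
  then have 1: "same_sign (w \<circ> ?g) w \<Longrightarrow> same_sign (?t \<circ> (w \<circ> ?g)) (?t \<circ> w)"
    using same_sign_theta[OF W(1) assms(1)] by blast
  have o: "coroot \<theta> \<bullet> (?t \<circ> w) \<gamma> = 0"
    using assms(3) theta_root by (simp add: coroot_inner_reflection root_nonzero)
  have "inv (?t \<circ> w \<circ> ?g) \<theta> = inv (?t \<circ> w) \<theta>"
    by (rule trans[OF inv_theta_reflection[OF W(3) assms(2)] reflection_inv_theta_orthogonal[OF W(3) assms(2) o]])
  then have "same_sign (?t \<circ> w \<circ> ?g) (?t \<circ> w) \<Longrightarrow>
    same_sign (?t \<circ> (?t \<circ> w \<circ> ?g)) (?t \<circ> (?t \<circ> w))"
    using same_sign_theta[OF W(4,3)] by blast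
  then show ?thesis using 1 by (auto simp only: comp_assoc comp_reflection_cancel)
qed

section \<open>The diamonds with \<theta> as statements about lengths and signs\<close>

context
  fixes w \<gamma>
  assumes w: "w \<in> M" and \<gamma>: "\<gamma> \<in> P"
begin

lemma w_weyl: "w \<in> W" and gamma_root: "\<gamma> \<in> \<Phi>" and gamma_pos: "0 < ht \<gamma>" and gamma_inner_pos: "0 < \<gamma> \<bullet> \<mu>"
  and w_gamma_root: "w \<gamma> \<in> \<Phi>" and w_reflection_weyl: "w \<circ> reflection \<gamma> \<in> W" and theta_w_weyl: "reflection \<theta> \<circ> w \<in> W"
proof -
  show 1: "w \<in> W" "\<gamma> \<in> \<Phi>" "0 < ht \<gamma>" "0 < \<gamma> \<bullet> \<mu>"
    using w \<gamma> M_weyl P_root P_pos unfolding P_def by blast+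
  show "w \<gamma> \<in> \<Phi>" "w \<circ> reflection \<gamma> \<in> W" "reflection \<theta> \<circ> w \<in> W"
    using 1 weyl_root weyl_comp weyl_reflection theta_root by blast+
qed

lemma refl_theta_inner:
  "reflection \<gamma> (inv w \<theta>) \<bullet> \<mu> = inv w \<theta> \<bullet> \<mu> - (coroot \<gamma> \<bullet> inv w \<theta>) * (\<gamma> \<bullet> \<mu>)"
  by (rule reflection_inner_left)

text \<open>The Bruhat edge makes w \<gamma> positive, so its pairing k with the coroot of \<theta>
  is nonnegative. Then r_\<gamma> moves \<open>inv w \<theta>\<close> further to the negative side
  of \<mu>, and k is 0 or 1; for k = 1 the product in \<open>lenJ_theta_reflection\<close> is
  exactly the quantum correction.\<close>

lemma diamond_2a:
  assumes "inv w \<theta> \<bullet> \<mu> < 0" "w \<circ> reflection \<gamma> \<in> M" "lenJ (w \<circ> reflection \<gamma>) = Suc (lenJ w)"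
  shows "reflection \<gamma> (inv w \<theta>) \<bullet> \<mu> < 0"
    and "coroot \<theta> \<bullet> w \<gamma> \<noteq> 0 \<Longrightarrow> is_quantum (reflection \<theta> \<circ> w) \<gamma>"
    and "coroot \<theta> \<bullet> w \<gamma> = 0 \<Longrightarrow> same_sign (reflection \<theta> \<circ> w \<circ> reflection \<gamma>) (reflection \<theta> \<circ> w) \<and>
      lenJ (reflection \<theta> \<circ> w \<circ> reflection \<gamma>) = Suc (lenJ (reflection \<theta> \<circ> w))"
proof -
  have "0 < ht (w \<gamma>)"
    using len_less_reflection_iff[OF w_weyl gamma_root gamma_pos] assms w len_M by simp
  then have k0: "0 \<le> coroot \<theta> \<bullet> w \<gamma>" using theta_inner_nonneg w_gamma_root by blast
  then have "0 \<le> coroot \<gamma> \<bullet> inv w \<theta>" using inner_coroot_inv_theta_iff(3)[OF w_weyl gamma_root] by linarith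
  then show b: "reflection \<gamma> (inv w \<theta>) \<bullet> \<mu> < 0"
    unfolding refl_theta_inner using assms(1) gamma_inner_pos by (smt (verit) mult_nonneg_nonneg)
  note l = lenJ_theta[OF w_weyl assms(1)] lenJ_theta_reflection[OF w_weyl gamma_root b]
  show "is_quantum (reflection \<theta> \<circ> w) \<gamma>" if "coroot \<theta> \<bullet> w \<gamma> \<noteq> 0"
  proof -
    \<comment> \<open>The preimage of \<theta> and the label \<gamma> lie on opposite sides of
      \<mu>, so no label has to be excluded here.\<close>
    have "w \<gamma> \<noteq> \<theta>" using assms(1) gamma_inner_pos w_weyl by auto
    then have "coroot \<theta> \<bullet> w \<gamma> = 1" using theta_coroot_pos[OF w_gamma_root] that k0 by simp
    then show ?thesis using l assms(3) unfolding is_quantum_def by simp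
  qed
  assume k: "coroot \<theta> \<bullet> w \<gamma> = 0"
  have "same_sign (w \<circ> reflection \<gamma>) w" using M_same_sign[OF w w_reflection_weyl] assms(2) by blast
  then show "same_sign (reflection \<theta> \<circ> w \<circ> reflection \<gamma>) (reflection \<theta> \<circ> w) \<and>
      lenJ (reflection \<theta> \<circ> w \<circ> reflection \<gamma>) = Suc (lenJ (reflection \<theta> \<circ> w))"
    using same_sign_orthogonal_iff[OF w_weyl gamma_root k] l assms(3) k by simp
qed

lemma diamond_2a_converse_orthogonal:
  assumes "coroot \<theta> \<bullet> w \<gamma> = 0" "reflection \<gamma> (inv w \<theta>) \<bullet> \<mu> < 0"
    "same_sign (reflection \<theta> \<circ> w \<circ> reflection \<gamma>) (reflection \<theta> \<circ> w)"
    "lenJ (reflection \<theta> \<circ> w \<circ> reflection \<gamma>) = Suc (lenJ (reflection \<theta> \<circ> w))"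
  shows "inv w \<theta> \<bullet> \<mu> < 0 \<and> w \<circ> reflection \<gamma> \<in> M \<and> lenJ (w \<circ> reflection \<gamma>) = Suc (lenJ w)"
proof -
  have a: "inv w \<theta> \<bullet> \<mu> < 0" using assms reflection_inv_theta_orthogonal[OF w_weyl gamma_root] by simp
  have "w \<circ> reflection \<gamma> \<in> M"
    using assms M_same_sign[OF w w_reflection_weyl] same_sign_orthogonal_iff[OF w_weyl gamma_root] by blast
  moreover have "real (lenJ (w \<circ> reflection \<gamma>)) = real (Suc (lenJ w))"
    using lenJ_theta[OF w_weyl a] lenJ_theta_reflection[OF w_weyl gamma_root assms(2)] assms by simp
  ultimately show ?thesis using a by simp
qed

text \<open>The quantum condition at r_\<theta> w gives r_\<theta> w \<gamma> < 0, hence pairing 1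
  of w \<gamma> with the coroot of \<theta>. Lengths then settle the length equation, but the sign
  of \<open>inv w \<theta>\<close> and the minimality of w r_\<gamma> each need the equality
  criterion at a root chosen for the purpose.\<close>

lemma diamond_2a_converse:
  assumes "coroot \<theta> \<bullet> w \<gamma> \<noteq> 0" "\<gamma> \<noteq> inv w \<theta>" "reflection \<gamma> (inv w \<theta>) \<bullet> \<mu> < 0"
    and q: "is_quantum (reflection \<theta> \<circ> w) \<gamma>"
  shows "inv w \<theta> \<bullet> \<mu> < 0 \<and> w \<circ> reflection \<gamma> \<in> M \<and> lenJ (w \<circ> reflection \<gamma>) = Suc (lenJ w)"
proof -
  let ?\<eta> = "inv w \<theta>" and ?t = "reflection \<theta>" and ?g = "reflection \<gamma>"
  have gg: "?g \<gamma> = - \<gamma>" by (simp add: reflection_self root_nonzero gamma_root)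
  note qD = quantumD[OF q theta_w_weyl \<gamma>]
  have "ht (?t (w \<gamma>)) < 0" using qD(1)[of \<gamma>] gamma_root gamma_inner_pos gg by simp
  then have kpos: "0 < coroot \<theta> \<bullet> w \<gamma>" using theta_reflection_pos_iff[OF w_gamma_root] assms(1) by force
  have ne: "w \<gamma> \<noteq> \<theta>" using assms(2) w_weyl by auto
  have k: "coroot \<theta> \<bullet> w \<gamma> = 1" using theta_coroot_pos[OF w_gamma_root ne kpos] .
  have wgpos: "0 < ht (w \<gamma>)" using theta_sign[OF w_gamma_root] kpos by blast
  have a: "?\<eta> \<bullet> \<mu> < 0"
  proof (rule ccontr)
    assume na: "\<not> ?thesis"
    \<comment> \<open>If the claim fails, this root lies in \<open>D \<gamma>\<close>. Pairing 1
      makes its image under \<open>w\<close> equal to w \<gamma> - \<theta>, which r_\<theta> sends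
      to the positive root w \<gamma>, whereas the criterion demands a negative one.\<close>
    let ?\<beta> = "- ?g ?\<eta>"
    have b: "?\<beta> \<in> \<Phi>" "0 < ?\<beta> \<bullet> \<mu>" using assms(3) inv_theta_root[OF w_weyl] reflection_root uminus_root gamma_root by auto
    have gb: "?g ?\<beta> = - ?\<eta>" by (simp add: linear_neg[OF linear_reflection])
    have "?\<beta> \<noteq> \<gamma>"
    proof
      assume "?\<beta> = \<gamma>"
      then have "- ?\<eta> = - \<gamma>" using gb gg by simp
      then show False using assms(2) by simp
    qed
    then have "coroot \<gamma> \<bullet> ?\<beta> = 1" "ht (?t (w ?\<beta>)) < 0"
      using qD[OF b] na gb by simp_all
    then have c: "coroot \<gamma> \<bullet> ?\<eta> = 1"
      by (simp add: coroot_inner_reflection root_nonzero gamma_root)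
    have "w ?\<beta> = w \<gamma> - \<theta>"
      by (simp add: reflection_def c weyl_diff weyl_uminus w_weyl)
    moreover have "?t (w \<gamma> - \<theta>) = w \<gamma>"
      using k theta_root by (simp add: reflection_def inner_diff_right coroot_inner_self root_nonzero)
    ultimately show False using \<open>ht (?t (w ?\<beta>)) < 0\<close> wgpos by simp
  qed
  have "real (lenJ (w \<circ> ?g)) = real (Suc (lenJ w))"
    using q lenJ_theta[OF w_weyl a] lenJ_theta_reflection[OF w_weyl gamma_root assms(3)] k
    unfolding is_quantum_def by simp
  moreover have "0 < ht (w (?g \<beta>))" if b: "\<beta> \<in> \<Phi>" "\<beta> \<bullet> \<mu> = 0" "0 < ht \<beta>" for \<beta>
  proof (rule ccontr)
    assume nc: "\<not> ?thesis"
    \<comment> \<open>This root also lies in \<open>D \<gamma>\<close>, its reflection being -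
      \<beta>, which is orthogonal to \<mu>. The criterion makes the images of \<beta> and of this
      root under \<open>w\<close> both positive and both negative after r_\<theta>, so each pairs
      with \<theta> to at least 1; but they add up to w \<gamma>, whose pairing is 1.\<close>
    let ?\<delta> = "- ?g \<beta>"
    have wb: "0 < ht (w \<beta>)" "w \<beta> \<in> \<Phi>" using M_pos[OF w b] weyl_root w_weyl b by auto
    have d: "?\<delta> \<in> \<Phi>" "w ?\<delta> \<in> \<Phi>" using b gamma_root reflection_root uminus_root weyl_root w_weyl by auto
    have gd: "?g ?\<delta> = - \<beta>" by (simp add: linear_neg[OF linear_reflection])
    have eqd: "?\<delta> = (coroot \<gamma> \<bullet> \<beta>) *\<^sub>R \<gamma> - \<beta>" by (simp add: reflection_def)
    have "ht (w (?g \<beta>)) \<le> 0" using nc by simp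
    then have "ht (w \<beta>) \<le> (coroot \<gamma> \<bullet> \<beta>) * ht (w \<gamma>)"
      by (simp add: reflection_def weyl_diff weyl_scale w_weyl)
    then have "0 < (coroot \<gamma> \<bullet> \<beta>) * ht (w \<gamma>)" using wb by simp
    then have "0 < coroot \<gamma> \<bullet> \<beta>" using wgpos by (simp add: zero_less_mult_iff)
    then have d\<mu>: "0 < ?\<delta> \<bullet> \<mu>" unfolding eqd using b gamma_inner_pos by (simp add: inner_diff_left)
    have "?\<delta> \<noteq> \<gamma>" using gd gg b gamma_inner_pos by auto
    then have "coroot \<gamma> \<bullet> ?\<delta> = 1" and td: "ht (?t (w ?\<delta>)) < 0" and tb: "ht (?t (w \<beta>)) < 0"
      using qD[OF d(1) d\<mu>] gd b by (simp_all add: weyl_uminus w_weyl linear_neg[OF linear_reflection])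
    then have "coroot \<gamma> \<bullet> \<beta> = 1" by (simp add: coroot_inner_reflection root_nonzero gamma_root)
    then have s: "w ?\<delta> = w \<gamma> - w \<beta>" unfolding eqd by (simp add: weyl_diff w_weyl)
    have "0 < ht (w ?\<delta>)" using nc root_ht_cases[OF d(2)] by (simp add: weyl_uminus w_weyl)
    then have "0 < coroot \<theta> \<bullet> w ?\<delta>" using td theta_reflection_pos_iff[OF d(2)] by force
    moreover have "0 < coroot \<theta> \<bullet> w \<beta>" using tb wb theta_reflection_pos_iff[OF wb(2)] by force
    moreover obtain m n where "coroot \<theta> \<bullet> w ?\<delta> = of_int m" "coroot \<theta> \<bullet> w \<beta> = of_int n"
      using coroot_Ints[OF theta_root] d wb Ints_cases by metis
    ultimately have "1 \<le> coroot \<theta> \<bullet> w ?\<delta>" "1 \<le> coroot \<theta> \<bullet> w \<beta>" by simp_all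
    moreover have "coroot \<theta> \<bullet> w ?\<delta> = 1 - coroot \<theta> \<bullet> w \<beta>" unfolding s using k by (simp add: inner_diff_right)
    ultimately show False by simp
  qed
  then have "w \<circ> ?g \<in> M" using w_reflection_weyl unfolding M_def by simp
  ultimately show ?thesis using a by simp
qed

text \<open>Here w \<gamma> < 0, and the excluded label gives w \<gamma> \<noteq> - \<theta>, so the
  pairing k of w \<gamma> with the coroot of \<theta> is 0 or -1. For k = -1 the product in
  \<open>lenJ_theta_reflection\<close> cancels the quantum correction of the hypothesis and leaves a
  length increase of one.\<close>

lemma diamond_2b:
  assumes "\<gamma> \<noteq> - inv w \<theta>" "inv w \<theta> \<bullet> \<mu> < 0" and q: "is_quantum w \<gamma>"
  shows "reflection \<gamma> (inv w \<theta>) \<bullet> \<mu> < 0"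
    and "coroot \<theta> \<bullet> w \<gamma> = 0 \<Longrightarrow> is_quantum (reflection \<theta> \<circ> w) \<gamma>"
    and "coroot \<theta> \<bullet> w \<gamma> \<noteq> 0 \<Longrightarrow> same_sign (reflection \<theta> \<circ> w \<circ> reflection \<gamma>) (reflection \<theta> \<circ> w) \<and>
      lenJ (reflection \<theta> \<circ> w \<circ> reflection \<gamma>) = Suc (lenJ (reflection \<theta> \<circ> w))"
proof -
  let ?\<eta> = "inv w \<theta>" and ?t = "reflection \<theta>" and ?g = "reflection \<gamma>"
  have gg: "?g \<gamma> = - \<gamma>" by (simp add: reflection_self root_nonzero gamma_root)
  note qD = quantumD[OF q w_weyl \<gamma>]
  have wgneg: "ht (w \<gamma>) < 0" using qD(1)[of \<gamma>] gamma_root gamma_inner_pos gg by simp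
  have kle: "coroot \<theta> \<bullet> w \<gamma> \<le> 0" using theta_sign(1)[OF w_gamma_root] wgneg by force
  have ne: "w \<gamma> \<noteq> - \<theta>" using assms(1) w_weyl by (metis weyl_inv_apply(1) weyl_inv weyl_uminus)
  show b: "?g ?\<eta> \<bullet> \<mu> < 0"
  proof (rule ccontr)
    assume nb: "\<not> ?thesis"
    \<comment> \<open>If the claim fails, the criterion applies to \<open>- ?\<eta>\<close>. With
      pairing 1, the image under \<open>w\<close> of its reflection is - \<theta> - w \<gamma>,
      which pairs with the coroot of \<theta> to -2 + 1 and is therefore negative, contrary to the
      criterion.\<close>
    have e: "- ?\<eta> \<in> \<Phi>" "0 < - ?\<eta> \<bullet> \<mu>" "?g (- ?\<eta>) \<bullet> \<mu> \<le> 0" "- ?\<eta> \<noteq> \<gamma>"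
      using assms nb inv_theta_root[OF w_weyl] uminus_root by (auto simp: linear_neg[OF linear_reflection])
    then have c: "coroot \<gamma> \<bullet> ?\<eta> = - 1" and pos: "0 < ht (w (?g (- ?\<eta>)))" using qD[OF e(1-3)] by auto
    then have "coroot \<theta> \<bullet> w \<gamma> = - 1"
      using theta_coroot_neg[OF w_gamma_root ne] inner_coroot_inv_theta_iff(3)[OF w_weyl gamma_root] by simp
    moreover have "w (?g (- ?\<eta>)) = - \<theta> - w \<gamma>"
      using c by (simp add: reflection_def weyl_diff weyl_uminus w_weyl)
    ultimately have "coroot \<theta> \<bullet> w (?g (- ?\<eta>)) < 0"
      using theta_root by (simp add: inner_diff_right coroot_inner_self root_nonzero)
    moreover have "w (?g (- ?\<eta>)) \<in> \<Phi>" using e gamma_root reflection_root weyl_root w_weyl by blast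
    ultimately show False using theta_sign(2) pos by fastforce
  qed
  note l = lenJ_theta[OF w_weyl assms(2)] lenJ_theta_reflection[OF w_weyl gamma_root b]
  show "coroot \<theta> \<bullet> w \<gamma> = 0 \<Longrightarrow> is_quantum (?t \<circ> w) \<gamma>"
    using l q unfolding is_quantum_def by simp
  assume k0: "coroot \<theta> \<bullet> w \<gamma> \<noteq> 0"
  then have k: "coroot \<theta> \<bullet> w \<gamma> = - 1" using theta_coroot_neg[OF w_gamma_root ne] kle by simp
  have "real (lenJ (?t \<circ> w \<circ> ?g)) = real (Suc (lenJ (?t \<circ> w)))"
    using l q k unfolding is_quantum_def by simp
  moreover have "same_sign (?t \<circ> w \<circ> ?g) (?t \<circ> w)"
  proof (rule same_signI[OF _ theta_w_weyl])
    show "?t \<circ> w \<circ> ?g \<in> W" using theta_w_weyl gamma_root weyl_comp weyl_reflection by blast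
    fix \<beta> assume b: "\<beta> \<in> \<Phi>" "\<beta> \<bullet> \<mu> = 0" "0 < ht ((?t \<circ> w) \<beta>)"
    show "0 < ht ((?t \<circ> w \<circ> ?g) \<beta>)"
    proof (rule ccontr)
      assume nc: "\<not> ?thesis"
      \<comment> \<open>The sign-reversed form of the argument in
        \<open>diamond_2a_converse\<close>: the images of \<beta> and of this root under
        \<open>w\<close> pair with \<theta> to at most -1 each, yet their sum w \<gamma> has pairing
        -1.\<close>
      let ?\<delta> = "- ?g \<beta>"
      have wb: "w \<beta> \<in> \<Phi>" using weyl_root w_weyl b by blast
      have d: "?\<delta> \<in> \<Phi>" "w ?\<delta> \<in> \<Phi>" "?t (w ?\<delta>) \<in> \<Phi>"
        using b gamma_root reflection_root uminus_root weyl_root w_weyl theta_root by auto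
      have gd: "?g ?\<delta> = - \<beta>" by (simp add: linear_neg[OF linear_reflection])
      have eqd: "?\<delta> = (coroot \<gamma> \<bullet> \<beta>) *\<^sub>R \<gamma> - \<beta>" by (simp add: reflection_def)
      have tg: "0 < ht (?t (w \<gamma>))" using theta_reflection_pos_iff[OF w_gamma_root] k by simp
      have "ht (?t (w (?g \<beta>))) = ht ((?t \<circ> w) \<beta>) - (coroot \<gamma> \<bullet> \<beta>) * ht (?t (w \<gamma>))"
        by (simp add: reflection_def[of \<gamma>] weyl_diff weyl_scale w_weyl linear_diff[OF linear_reflection]
            linear_cmul[OF linear_reflection])
      then have "0 < (coroot \<gamma> \<bullet> \<beta>) * ht (?t (w \<gamma>))" using nc b by simp
      then have "0 < coroot \<gamma> \<bullet> \<beta>" using tg by (simp add: zero_less_mult_iff)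
      then have d\<mu>: "0 < ?\<delta> \<bullet> \<mu>" unfolding eqd using b gamma_inner_pos by (simp add: inner_diff_left)
      have "?\<delta> \<noteq> \<gamma>" using gd gg b gamma_inner_pos by auto
      then have "coroot \<gamma> \<bullet> ?\<delta> = 1" and dneg: "ht (w ?\<delta>) < 0" and bneg: "ht (w \<beta>) < 0"
        using qD[OF d(1) d\<mu>] gd b by (simp_all add: weyl_uminus w_weyl)
      then have "coroot \<gamma> \<bullet> \<beta> = 1" by (simp add: coroot_inner_reflection root_nonzero gamma_root)
      then have s: "w ?\<delta> = w \<gamma> - w \<beta>" unfolding eqd by (simp add: weyl_diff w_weyl)
      have "0 < ht (?t (w ?\<delta>))" using nc root_ht_cases[OF d(3)]
        by (simp add: weyl_uminus w_weyl linear_neg[OF linear_reflection])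
      then have "coroot \<theta> \<bullet> w ?\<delta> < 0" using dneg theta_reflection_pos_iff[OF d(2)] by force
      moreover have "coroot \<theta> \<bullet> w \<beta> < 0" using b bneg theta_reflection_pos_iff[OF wb] by force
      moreover obtain m n where "coroot \<theta> \<bullet> w ?\<delta> = of_int m" "coroot \<theta> \<bullet> w \<beta> = of_int n"
        using coroot_Ints[OF theta_root] d wb Ints_cases by metis
      ultimately have "coroot \<theta> \<bullet> w ?\<delta> \<le> - 1" "coroot \<theta> \<bullet> w \<beta> \<le> - 1" by simp_all
      moreover have "coroot \<theta> \<bullet> w ?\<delta> = - 1 - coroot \<theta> \<bullet> w \<beta>" unfolding s using k by (simp add: inner_diff_right)
      ultimately show False by simp
    qed
  qed
  ultimately show "same_sign (?t \<circ> w \<circ> ?g) (?t \<circ> w) \<and> lenJ (?t \<circ> w \<circ> ?g) = Suc (lenJ (?t \<circ> w))"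
    by simp
qed

lemma diamond_2b_converse_orthogonal:
  assumes "coroot \<theta> \<bullet> w \<gamma> = 0" "reflection \<gamma> (inv w \<theta>) \<bullet> \<mu> < 0" "is_quantum (reflection \<theta> \<circ> w) \<gamma>"
  shows "inv w \<theta> \<bullet> \<mu> < 0 \<and> is_quantum w \<gamma>"
proof -
  have a: "inv w \<theta> \<bullet> \<mu> < 0" using assms reflection_inv_theta_orthogonal[OF w_weyl gamma_root] by simp
  then show ?thesis
    using lenJ_theta[OF w_weyl a] lenJ_theta_reflection[OF w_weyl gamma_root assms(2)] assms
    unfolding is_quantum_def by simp
qed

text \<open>The hypothesis is an actual edge because the sign of r_\<theta> w \<gamma> is read off
  from the length increase at the minimal representative, where \<open>len\<close> and
  \<open>lenJ\<close> agree. This sign gives negative pairing of w \<gamma> with \<theta>, and then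
  \<open>inv w \<theta>\<close> lies on the negative side of \<mu> because its reflection
  does.\<close>

lemma diamond_2b_converse:
  assumes "coroot \<theta> \<bullet> w \<gamma> \<noteq> 0" "reflection \<gamma> (inv w \<theta>) \<bullet> \<mu> < 0"
    "bruhat_edge \<Phi> \<Delta> \<mu> (fl (reflection \<theta> \<circ> w)) (z \<gamma>) (fl (reflection \<theta> \<circ> w \<circ> reflection \<gamma>))"
    "z \<in> W\<^sub>J" "reflection \<theta> \<circ> w = fl (reflection \<theta> \<circ> w) \<circ> z"
  shows "inv w \<theta> \<bullet> \<mu> < 0 \<and> is_quantum w \<gamma>"
proof -
  let ?\<eta> = "inv w \<theta>" and ?t = "reflection \<theta>" and ?x = "fl (reflection \<theta> \<circ> w)"
  have x: "?x \<in> M" "z \<gamma> \<in> P" "?x \<circ> reflection (z \<gamma>) \<in> M"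
    "lenJ (?x \<circ> reflection (z \<gamma>)) = Suc (lenJ ?x)"
    using assms(3) unfolding bruhat_edge_iff by blast+
  have l: "lenJ (?t \<circ> w \<circ> reflection \<gamma>) = Suc (lenJ (?t \<circ> w))"
    using assms(3) bruhat_edge_stab_iff[OF theta_w_weyl assms(4,5) \<gamma>] by blast
  have "len \<Delta> ?x < len \<Delta> (?x \<circ> reflection (z \<gamma>))" using x len_M by simp
  then have "0 < ht (?x (z \<gamma>))"
    using len_less_reflection_iff[of ?x "z \<gamma>"] x M_weyl P_root P_pos by blast
  moreover have "?x (z \<gamma>) = ?t (w \<gamma>)" using fun_cong[OF assms(5), of \<gamma>] by simp
  ultimately have neg: "coroot \<theta> \<bullet> w \<gamma> < 0" using theta_reflection_pos_iff[OF w_gamma_root] assms(1) by simp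
  \<comment> \<open>In that case r_\<gamma> would send \<open>inv w \<theta>\<close> to \<gamma>,
    which pairs positively with \<mu>; so the upper quantum edge itself rules this label
    out.\<close>
  have "w \<gamma> \<noteq> - \<theta>"
  proof
    assume "w \<gamma> = - \<theta>"
    then have "?\<eta> = - \<gamma>" using w_weyl by (metis weyl_inv_apply(1) weyl_uminus add.inverse_inverse)
    then show False using assms(2) gamma_inner_pos gamma_root by (simp add: linear_neg[OF linear_reflection] reflection_self root_nonzero)
  qed
  then have k: "coroot \<theta> \<bullet> w \<gamma> = - 1" using theta_coroot_neg[OF w_gamma_root] neg by blast
  have "coroot \<gamma> \<bullet> ?\<eta> < 0" using inner_coroot_inv_theta_iff(3)[OF w_weyl gamma_root] neg by blast
  then have "(coroot \<gamma> \<bullet> ?\<eta>) * (\<gamma> \<bullet> \<mu>) < 0" using gamma_inner_pos by (simp add: mult_neg_pos)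
  then have a: "?\<eta> \<bullet> \<mu> < 0" using assms(2) unfolding refl_theta_inner by simp
  then show ?thesis
    using lenJ_theta[OF w_weyl a] lenJ_theta_reflection[OF w_weyl gamma_root assms(2)] l k
    unfolding is_quantum_def by simp
qed

end

text \<open>Dictionary between the edges of the diamonds with \<theta> and conditions on lengths,
  signs and pairings. Once it is applied, only the split on the vanishing of the pairing
  remains.\<close>

lemma case_2_edges:
  assumes "w \<in> M" "\<gamma> \<in> P" "z \<in> W\<^sub>J" "reflection \<theta> \<circ> w = fl (reflection \<theta> \<circ> w) \<circ> z"
  shows "quantum_edge \<Phi> \<Delta> \<mu> w (- inv w \<theta>) (fl (reflection \<theta> \<circ> w)) \<longleftrightarrow> inv w \<theta> \<bullet> \<mu> < 0"
    and "quantum_edge \<Phi> \<Delta> \<mu> (fl (w \<circ> reflection \<gamma>)) (- inv (fl (w \<circ> reflection \<gamma>)) \<theta>)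
      (fl (reflection \<theta> \<circ> w \<circ> reflection \<gamma>)) \<longleftrightarrow> reflection \<gamma> (inv w \<theta>) \<bullet> \<mu> < 0"
    and "bruhat_edge \<Phi> \<Delta> \<mu> w \<gamma> (fl (w \<circ> reflection \<gamma>)) \<longleftrightarrow>
      w \<circ> reflection \<gamma> \<in> M \<and> lenJ (w \<circ> reflection \<gamma>) = Suc (lenJ w)"
    and "quantum_edge \<Phi> \<Delta> \<mu> w \<gamma> (fl (w \<circ> reflection \<gamma>)) \<longleftrightarrow> is_quantum w \<gamma>"
    and "inv w \<theta> \<bullet> coroot \<gamma> = 0 \<longleftrightarrow> coroot \<theta> \<bullet> w \<gamma> = 0"
    and "quantum_edge \<Phi> \<Delta> \<mu> (fl (reflection \<theta> \<circ> w)) (z \<gamma>) (fl (reflection \<theta> \<circ> w \<circ> reflection \<gamma>))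
      \<longleftrightarrow> is_quantum (reflection \<theta> \<circ> w) \<gamma>"
    and "bruhat_edge \<Phi> \<Delta> \<mu> (fl (reflection \<theta> \<circ> w)) (z \<gamma>) (fl (reflection \<theta> \<circ> w \<circ> reflection \<gamma>))
      \<longleftrightarrow> same_sign (reflection \<theta> \<circ> w \<circ> reflection \<gamma>) (reflection \<theta> \<circ> w) \<and>
        lenJ (reflection \<theta> \<circ> w \<circ> reflection \<gamma>) = Suc (lenJ (reflection \<theta> \<circ> w))"
proof -
  have W: "w \<in> W" "\<gamma> \<in> \<Phi>" "w \<circ> reflection \<gamma> \<in> W" "reflection \<theta> \<circ> w \<in> W"
    using assms M_weyl P_root weyl_comp weyl_reflection theta_root by auto
  show "quantum_edge \<Phi> \<Delta> \<mu> w (- inv w \<theta>) (fl (reflection \<theta> \<circ> w)) \<longleftrightarrow> inv w \<theta> \<bullet> \<mu> < 0"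
    using quantum_edge_theta_iff[OF W(1)] fl_id[OF assms(1)] by simp
  show "quantum_edge \<Phi> \<Delta> \<mu> (fl (w \<circ> reflection \<gamma>)) (- inv (fl (w \<circ> reflection \<gamma>)) \<theta>)
      (fl (reflection \<theta> \<circ> w \<circ> reflection \<gamma>)) \<longleftrightarrow> reflection \<gamma> (inv w \<theta>) \<bullet> \<mu> < 0"
    using quantum_edge_theta_iff[OF W(3)] inv_theta_reflection[OF W(1,2)] by (simp only: comp_assoc)
  show "bruhat_edge \<Phi> \<Delta> \<mu> w \<gamma> (fl (w \<circ> reflection \<gamma>)) \<longleftrightarrow>
      w \<circ> reflection \<gamma> \<in> M \<and> lenJ (w \<circ> reflection \<gamma>) = Suc (lenJ w)"
    unfolding bruhat_edge_iff using assms fl_id by blast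
  show "quantum_edge \<Phi> \<Delta> \<mu> w \<gamma> (fl (w \<circ> reflection \<gamma>)) \<longleftrightarrow> is_quantum w \<gamma>"
    unfolding quantum_edge_iff is_quantum_def using assms by blast
  show "inv w \<theta> \<bullet> coroot \<gamma> = 0 \<longleftrightarrow> coroot \<theta> \<bullet> w \<gamma> = 0"
    by (rule inner_coroot_inv_theta_iff(1)[OF W(1,2)])
qed (use assms M_weyl theta_root weyl_comp weyl_reflection
    quantum_edge_stab_iff bruhat_edge_stab_iff in blast)+

end

theorem lemma3p2:
  fixes \<Phi> \<Delta> :: "'a::euclidean_space set"
    and \<mu> \<alpha> \<gamma> \<theta> :: 'a
    and w z :: "'a \<Rightarrow> 'a"
  assumes "irreducible_root_system \<Phi>" and "is_base \<Phi> \<Delta>"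
    and "\<mu> \<in> weight_lattice \<Phi>" and "dominant \<Delta> \<mu>"
    and "\<alpha> \<in> \<Delta>"
    and "\<gamma> \<in> pos_roots \<Phi> \<Delta> - pos_roots_stab \<Phi> \<Delta> \<mu>"
    and "w \<in> min_reps \<Phi> \<Delta> \<mu>"
    and "highest_root \<Phi> \<Delta> \<theta>"
    and "z \<in> W_stab \<Phi> \<mu>"
    and "reflection \<theta> \<circ> w = min_rep \<Phi> \<Delta> \<mu> (reflection \<theta> \<circ> w) \<circ> z"
  shows
    "let r = reflection; fl = min_rep \<Phi> \<Delta> \<mu>;
         B = bruhat_edge \<Phi> \<Delta> \<mu>; Q = quantum_edge \<Phi> \<Delta> \<mu> in
        ((\<gamma> \<noteq> inv w \<alpha> \<and>
         B w (inv w \<alpha>) (r \<alpha> \<circ> w) \<and>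
         B w \<gamma> (fl (w \<circ> r \<gamma>))
         \<longrightarrow>
         B (r \<alpha> \<circ> w) \<gamma> (r \<alpha> \<circ> fl (w \<circ> r \<gamma>)) \<and>
         B (fl (w \<circ> r \<gamma>)) (inv (fl (w \<circ> r \<gamma>)) \<alpha>)
           (r \<alpha> \<circ> fl (w \<circ> r \<gamma>)) \<and>
         r \<alpha> \<circ> fl (w \<circ> r \<gamma>) = fl (r \<alpha> \<circ> w \<circ> r \<gamma>)) \<and>
        (\<gamma> \<noteq> - inv w \<alpha> \<and>
         B (r \<alpha> \<circ> w) \<gamma> (r \<alpha> \<circ> fl (w \<circ> r \<gamma>)) \<and>
         B (fl (w \<circ> r \<gamma>)) (inv (fl (w \<circ> r \<gamma>)) \<alpha>)
           (r \<alpha> \<circ> fl (w \<circ> r \<gamma>))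
         \<longrightarrow>
         B w (inv w \<alpha>) (r \<alpha> \<circ> w) \<and>
         B w \<gamma> (fl (w \<circ> r \<gamma>)) \<and>
         r \<alpha> \<circ> fl (w \<circ> r \<gamma>) = fl (r \<alpha> \<circ> w \<circ> r \<gamma>))) \<and>
        ((B w (inv w \<alpha>) (r \<alpha> \<circ> w) \<and>
         Q w \<gamma> (fl (w \<circ> r \<gamma>))
         \<longrightarrow>
         Q (r \<alpha> \<circ> w) \<gamma> (r \<alpha> \<circ> fl (w \<circ> r \<gamma>)) \<and>
         B (fl (w \<circ> r \<gamma>)) (inv (fl (w \<circ> r \<gamma>)) \<alpha>)
           (r \<alpha> \<circ> fl (w \<circ> r \<gamma>)) \<and>
         r \<alpha> \<circ> fl (w \<circ> r \<gamma>) = fl (r \<alpha> \<circ> w \<circ> r \<gamma>)) \<and>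
        (Q (r \<alpha> \<circ> w) \<gamma> (r \<alpha> \<circ> fl (w \<circ> r \<gamma>)) \<and>
         B (fl (w \<circ> r \<gamma>)) (inv (fl (w \<circ> r \<gamma>)) \<alpha>)
           (r \<alpha> \<circ> fl (w \<circ> r \<gamma>))
         \<longrightarrow>
         B w (inv w \<alpha>) (r \<alpha> \<circ> w) \<and>
         Q w \<gamma> (fl (w \<circ> r \<gamma>)) \<and>
         r \<alpha> \<circ> fl (w \<circ> r \<gamma>) = fl (r \<alpha> \<circ> w \<circ> r \<gamma>))) \<and>
        ((Q w (- inv w \<theta>) (fl (r \<theta> \<circ> w)) \<and>
         B w \<gamma> (fl (w \<circ> r \<gamma>))
         \<longrightarrow>
         (if inv w \<theta> \<bullet> coroot \<gamma> \<noteq> 0 then Q else B)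
           (fl (r \<theta> \<circ> w)) (z \<gamma>) (fl (r \<theta> \<circ> w \<circ> r \<gamma>)) \<and>
         Q (fl (w \<circ> r \<gamma>)) (- inv (fl (w \<circ> r \<gamma>)) \<theta>)
           (fl (r \<theta> \<circ> w \<circ> r \<gamma>))) \<and>
        ((inv w \<theta> \<bullet> coroot \<gamma> \<noteq> 0 \<longrightarrow> \<gamma> \<noteq> inv w \<theta>) \<and>
         (if inv w \<theta> \<bullet> coroot \<gamma> \<noteq> 0 then Q else B)
           (fl (r \<theta> \<circ> w)) (z \<gamma>) (fl (r \<theta> \<circ> w \<circ> r \<gamma>)) \<and>
         Q (fl (w \<circ> r \<gamma>)) (- inv (fl (w \<circ> r \<gamma>)) \<theta>)
           (fl (r \<theta> \<circ> w \<circ> r \<gamma>))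
         \<longrightarrow>
         Q w (- inv w \<theta>) (fl (r \<theta> \<circ> w)) \<and>
         B w \<gamma> (fl (w \<circ> r \<gamma>)))) \<and>
        ((\<gamma> \<noteq> - inv w \<theta> \<and>
         Q w (- inv w \<theta>) (fl (r \<theta> \<circ> w)) \<and>
         Q w \<gamma> (fl (w \<circ> r \<gamma>))
         \<longrightarrow>
         (if inv w \<theta> \<bullet> coroot \<gamma> \<noteq> 0 then B else Q)
           (fl (r \<theta> \<circ> w)) (z \<gamma>) (fl (r \<theta> \<circ> w \<circ> r \<gamma>)) \<and>
         Q (fl (w \<circ> r \<gamma>)) (- inv (fl (w \<circ> r \<gamma>)) \<theta>)
           (fl (r \<theta> \<circ> w \<circ> r \<gamma>))) \<and>
        ((if inv w \<theta> \<bullet> coroot \<gamma> \<noteq> 0 then B else Q)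
           (fl (r \<theta> \<circ> w)) (z \<gamma>) (fl (r \<theta> \<circ> w \<circ> r \<gamma>)) \<and>
         Q (fl (w \<circ> r \<gamma>)) (- inv (fl (w \<circ> r \<gamma>)) \<theta>)
           (fl (r \<theta> \<circ> w \<circ> r \<gamma>))
         \<longrightarrow>
         Q w (- inv w \<theta>) (fl (r \<theta> \<circ> w)) \<and>
         Q w \<gamma> (fl (w \<circ> r \<gamma>))))"
proof -
  interpret highest_root_system \<Phi> \<Delta> \<mu> \<theta>
    using assms by unfold_locales (auto simp: irreducible_root_system_def)
  have w: "w \<in> M" using assms(7) min_reps_eq by simp
  have \<gamma>: "\<gamma> \<in> P" using assms(6) P_eq by simp
  note e = case_2_edges[OF w \<gamma> assms(9,10)]
  show ?thesis
    unfolding Let_def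
  proof (intro conjI, goal_cases)
    case 1
    show ?case using case_1a[OF assms(5)] by blast
  next
    case 2
    show ?case using case_1a_converse[OF w assms(5)] by blast
  next
    case 3
    show ?case using case_1b[OF assms(5)] by blast
  next
    case 4
    show ?case using case_1b_converse[OF w assms(5)] by blast
  next
    case 5
    show ?case
      using diamond_2a[OF w \<gamma>]
      by (cases "inv w \<theta> \<bullet> coroot \<gamma> = 0") (simp_all add: e del: comp_apply)
  next
    case 6
    show ?case
      using diamond_2a_converse_orthogonal[OF w \<gamma>] diamond_2a_converse[OF w \<gamma>]
      by (cases "inv w \<theta> \<bullet> coroot \<gamma> = 0") (simp_all add: e del: comp_apply)
  next
    case 7
    show ?case
      using diamond_2b[OF w \<gamma>]
      by (cases "inv w \<theta> \<bullet> coroot \<gamma> = 0") (simp_all add: e del: comp_apply)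
  next
    case 8
    show ?case
      using diamond_2b_converse_orthogonal[OF w \<gamma>] diamond_2b_converse[OF w \<gamma> _ _ _ assms(9,10)]
      by (cases "inv w \<theta> \<bullet> coroot \<gamma> = 0") (simp_all add: e del: comp_apply)
  qed
qed

end
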